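(* Let $A,B$ be simple graphs of orders $a=v(A)$ and $b=v(B)$ satisfying $3\le a\le b$. Then $$Q(A\vee B)\ge D_a\,\lambda_a^{\,b-a}\left(\frac ab\right)^{2a-2}.$$
   Context: All graphs are finite and simple; $v(G)$ denotes the number of vertices (order) of $G$. For a graph $G$, $\alpha(G)$ is the number of acyclic orientations of $G$ and $\alpha^{*}(G)$ is the number of totally cyclic orientations of $G$ (orientations in which every edge lies on a directed cycle). For a connected graph $G$, $\tau(G)$ is the number of spanning trees of $G$. (In terms of the Tutte polynomial, $\alpha(G)=T(G;2,0)$, $\alpha^{*}(G)=T(G;0,2)$, $\tau(G)=T(G;1,1)$.) For connected $G$, define $Q(G)=\alpha(G)\alpha^{*}(G)/\tau(G)^2$. The join $A\vee B$ is obtained from the disjoint union of $A$ and $B$ by adding all edges between $V(A)$ and $V(B)$. For an integer $s\ge2$, $\lambda_s=(s+1)(2^s-2)/s^2$. Set $D_3=34/15$, and for integers $a\ge4$, $$D_a=\frac{34}{15}\prod_{j=3}^{a-1}\left(\lambda_j\lambda_{j+1}\left(\frac{j}{j+1}\right)^{4j-2}\right).$$ *)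

theory Defs
  imports Complex_Main "Graph_Theory.Digraph_Component" "Graph_Theory.Pair_Digraph"
begin

text \<open>
  Finite simple graphs are \<^locale>\<open>pair_graph\<close>s: finite, symmetric, loop-free digraphs whose arcs
  are ordered pairs of vertices, so that an edge \<open>uv\<close> is represented by both arcs
  \<open>(u,v)\<close> and \<open>(v,u)\<close>.
\<close>

definition orientation :: "'a pair_pre_digraph \<Rightarrow> 'a pair_pre_digraph \<Rightarrow> bool" where
  "orientation D G \<longleftrightarrow> pverts D = pverts G \<and> parcs D \<union> (parcs D)\<inverse> = parcs G \<and>
     parcs D \<inter> (parcs D)\<inverse> = {}"

definition acyclic_orientation :: "'a pair_pre_digraph \<Rightarrow> 'a pair_pre_digraph \<Rightarrow> bool" where
  "acyclic_orientation D G \<longleftrightarrow> orientation D G \<and> \<not> (\<exists>p. pre_digraph.cycle (with_proj D) p)"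

definition totally_cyclic_orientation :: "'a pair_pre_digraph \<Rightarrow> 'a pair_pre_digraph \<Rightarrow> bool" where
  "totally_cyclic_orientation D G \<longleftrightarrow> orientation D G \<and>
     (\<forall>e\<in>parcs D. \<exists>p. pre_digraph.cycle (with_proj D) p \<and> e \<in> set p)"

text \<open>
  The library predicate \<^const>\<open>tree\<close> forbids all directed cycles, including the closed walk
  \<open>u, v, u\<close> that every edge of a symmetric digraph gives rise to. The cycles of a simple graph
  are the directed cycles of length at least three of its symmetric digraph.
\<close>

definition undirected_tree :: "'a pair_pre_digraph \<Rightarrow> bool" where
  "undirected_tree T \<longleftrightarrow> pair_graph T \<and> Digraph_Component.connected (with_proj T) \<and>
     \<not> (\<exists>p. pre_digraph.cycle (with_proj T) p \<and> 3 \<le> length p)"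

definition undirected_spanning_tree :: "'a pair_pre_digraph \<Rightarrow> 'a pair_pre_digraph \<Rightarrow> bool" where
  "undirected_spanning_tree T G \<longleftrightarrow> undirected_tree T \<and> spanning (with_proj T) (with_proj G)"

definition num_acyclic :: "'a pair_pre_digraph \<Rightarrow> nat" where
  "num_acyclic G = card {D. acyclic_orientation D G}"

definition num_totally_cyclic :: "'a pair_pre_digraph \<Rightarrow> nat" where
  "num_totally_cyclic G = card {D. totally_cyclic_orientation D G}"

definition num_spanning_trees :: "'a pair_pre_digraph \<Rightarrow> nat" where
  "num_spanning_trees G = card {T. undirected_spanning_tree T G}"

text \<open>Meaningful for connected \<open>G\<close>, where the denominator is nonzero.\<close>

definition Q_ratio :: "'a pair_pre_digraph \<Rightarrow> real" where
  "Q_ratio G = real (num_acyclic G) * real (num_totally_cyclic G) / (real (num_spanning_trees G))\<^sup>2"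

definition graph_join ::
    "'a pair_pre_digraph \<Rightarrow> 'b pair_pre_digraph \<Rightarrow> ('a + 'b) pair_pre_digraph" where
  "graph_join A B =
     \<lparr> pverts = pverts A <+> pverts B,
       parcs = map_prod Inl Inl ` parcs A \<union> map_prod Inr Inr ` parcs B
         \<union> (Inl ` pverts A) \<times> (Inr ` pverts B) \<union> (Inr ` pverts B) \<times> (Inl ` pverts A) \<rparr>"

definition lambda_const :: "nat \<Rightarrow> real" where
  "lambda_const s = (real s + 1) * (2 ^ s - 2) / (real s)\<^sup>2"

text \<open>For \<open>a = 3\<close> the product is empty; only \<open>a \<ge> 3\<close> is of interest.\<close>

definition D_const :: "nat \<Rightarrow> real" where
  "D_const a = 34 / 15 *
     (\<Prod>j = 3..<a. lambda_const j * lambda_const (j + 1) * (real j / real (j + 1)) ^ (4 * j - 2))"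

end

theory Submission
  imports Defs "HOL-Library.FuncSet"
begin

text \<open>
  Write \<open>\<alpha>\<close>, \<open>\<alpha>*\<close> and \<open>\<tau>\<close> for the numbers of acyclic orientations, totally cyclic
  orientations and spanning trees. A join is built up by adding one vertex at a time, and the
  claimed bound is the product of what the single additions contribute. Let a new vertex \<open>v\<close> be
  joined to all \<open>a\<close> vertices of one side and to \<open>k\<close> of the \<open>b\<close> vertices already present on its own
  side; its degree is \<open>d = a + k\<close>.

  \<^item> \<open>\<alpha>\<close> grows at least by the factor \<open>d + 1\<close>: list the old vertices so that all arcs point
    forwards; \<open>v\<close> can be put into \<open>d + 1\<close> essentially different places
    (\<open>acyclic_count_vertex\<close>).
  \<^item> \<open>\<alpha>*\<close> grows at least by the factor \<open>2^d - 2\<close>: a strongly connected orientation stays strongly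
    connected when \<open>v\<close> receives at least one incoming and one outgoing arc
    (\<open>strong_count_vertex\<close>).
  \<^item> \<open>\<tau>\<close> grows at most by the factor
    \<open>a (1 + 1/b)^(a-1) \<cdot> (1 + 1/a)^k (a + k + 1) / (a + 1)\<close> (\<open>tree_count_joined_vertex\<close>).

  For \<open>k = 0\<close> the quotient of these factors, with the one of \<open>\<tau>\<close> squared, is exactly
  \<open>\<lambda>_a (b / (b+1))^(2a-2)\<close>, and \<open>power_degree_bound\<close> says that \<open>k > 0\<close> only helps. Growing the
  larger side from \<open>a\<close> to \<open>b\<close> vertices therefore yields \<open>\<lambda>_a^(b-a) (a/b)^(2a-2)\<close>, and growing both
  sides from \<open>j\<close> to \<open>j + 1\<close> vertices yields the \<open>j\<close>-th factor of \<open>D_a\<close>.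

  The upper bound for \<open>\<tau>\<close> is the heart of the matter. It follows from \<open>exchange_count\<close>, a double
  counting of edge exchanges: from a spanning tree that contains the edge \<open>vu\<close>, delete that edge
  and reconnect the two components through a common neighbour \<open>w\<close> of \<open>u\<close> and of some vertices that
  are tied to \<open>v\<close>. Applied repeatedly, it bounds the number of trees in which \<open>v\<close> has a prescribed
  set \<open>S\<close> of neighbours in terms of \<open>card S\<close> alone; summing over \<open>S\<close> gives the factor above.

  It remains to treat two sides of three vertices, where \<open>Q \<ge> 34/15\<close> has to be shown. There all
  edges inside the two sides are removed, which compares \<open>\<tau>\<close> and \<open>\<alpha>*\<close> with those of \<open>K_{3,3}\<close>,
  namely \<open>81\<close> and \<open>102\<close>, while \<open>\<alpha>\<close> is bounded directly by adding vertices (\<open>ratio_ge_33\<close>).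

  Throughout, a simple graph is a vertex set with a symmetric irreflexive relation, and counting
  strongly connected orientations instead of totally cyclic ones suffices for a lower bound.
\<close>

section \<open>Counting orientations\<close>

definition simple_edges :: "'v set \<Rightarrow> 'v rel \<Rightarrow> bool" where
  "simple_edges V E \<longleftrightarrow> finite V \<and> E \<subseteq> V \<times> V \<and> sym E \<and> irrefl E"

definition orients :: "'v rel \<Rightarrow> 'v rel \<Rightarrow> bool" where
  "orients D E \<longleftrightarrow> D \<union> D\<inverse> = E \<and> D \<inter> D\<inverse> = {}"

definition strong_on :: "'v set \<Rightarrow> 'v rel \<Rightarrow> bool" where
  "strong_on V D \<longleftrightarrow> V \<times> V \<subseteq> D\<^sup>*"

definition acyclic_count :: "'v rel \<Rightarrow> nat" where
  "acyclic_count E = card {D. orients D E \<and> acyclic D}"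

definition strong_count :: "'v set \<Rightarrow> 'v rel \<Rightarrow> nat" where
  "strong_count V E = card {D. orients D E \<and> strong_on V D}"

definition del_vertex :: "'v \<Rightarrow> 'v rel \<Rightarrow> 'v rel" where
  "del_vertex v E = {(x, y) \<in> E. x \<noteq> v \<and> y \<noteq> v}"

text \<open>
  Extends an orientation \<open>D\<close> to a further vertex \<open>v\<close> with neighbourhood \<open>N\<close>; the set \<open>L\<close> of
  in-neighbours of \<open>v\<close> determines the extension.
\<close>

definition attach :: "'v \<Rightarrow> 'v set \<Rightarrow> 'v rel \<Rightarrow> 'v set \<Rightarrow> 'v rel" where
  "attach v N D L = D \<union> L \<times> {v} \<union> {v} \<times> (N - L)"

lemma simple_edgesD:
  assumes "simple_edges V E"
  shows "finite V" "E \<subseteq> V \<times> V" "sym E" "irrefl E" "finite E"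
  using assms finite_subset[of E "V \<times> V"] by (auto simp: simple_edges_def)

lemma finite_orients: "finite E \<Longrightarrow> finite {D. orients D E \<and> P D}"
  by (rule finite_subset[of _ "Pow E"]) (auto simp: orients_def)

lemma orients_attach:
  assumes "sym E" "irrefl E" "orients D (del_vertex v E)" "L \<subseteq> E `` {v}"
  shows "orients (attach v (E `` {v}) D L) E"
proof -
  have D: "D \<union> D\<inverse> = del_vertex v E" "D \<inter> D\<inverse> = {}" using assms(3) by (auto simp: orients_def)
  have nv: "(x, v) \<notin> D \<and> (v, x) \<notin> D" for x using D(1) by (auto simp: del_vertex_def)
  have vv: "(v, v) \<notin> E" using assms(2) by (auto simp: irrefl_def)
  have sE: "(x, y) \<in> E \<longleftrightarrow> (y, x) \<in> E" for x y using assms(1) by (auto dest: symD)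
  have "attach v (E `` {v}) D L \<union> (attach v (E `` {v}) D L)\<inverse>
      = (D \<union> D\<inverse>) \<union> E `` {v} \<times> {v} \<union> {v} \<times> E `` {v}"
    using assms(4) by (auto simp: attach_def)
  also have "\<dots> = E" unfolding D(1) using sE by (auto simp: del_vertex_def)
  finally have 1: "attach v (E `` {v}) D L \<union> (attach v (E `` {v}) D L)\<inverse> = E" .
  have vL: "v \<notin> E `` {v}" using vv by auto
  have "attach v (E `` {v}) D L \<inter> (attach v (E `` {v}) D L)\<inverse> = {}"
    using D(2) nv vL assms(4) by (auto simp: attach_def)
  with 1 show ?thesis by (simp add: orients_def)
qed

lemma attach_inj:
  assumes "attach v N D L = attach v N D' L'" "\<And>x. (x, v) \<notin> D \<and> (v, x) \<notin> D"
    "\<And>x. (x, v) \<notin> D' \<and> (v, x) \<notin> D'" "v \<notin> N" "L \<subseteq> N" "L' \<subseteq> N"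
  shows "D = D' \<and> L = L'"
proof -
  have "D = del_vertex v (attach v N D L)"
    if "\<And>x. (x, v) \<notin> D \<and> (v, x) \<notin> D" for D L using that by (auto simp: del_vertex_def attach_def)
  moreover have "L = {x. (x, v) \<in> attach v N D L}"
    if "\<And>x. (x, v) \<notin> D \<and> (v, x) \<notin> D" "v \<notin> N" for D L using that by (auto simp: attach_def)
  ultimately show ?thesis using assms by metis
qed

text \<open>
  Distinct pairs of an orientation without \<open>v\<close> and a set of in-neighbours give distinct
  orientations with \<open>v\<close>, so a lower bound on the number of good extensions of each orientation
  multiplies. Both vertex bounds below are instances.
\<close>

lemma attach_count:
  assumes "finite E" "sym E" "irrefl E"
    and m: "\<And>D. orients D (del_vertex v E) \<Longrightarrow> P D \<Longrightarrow>
      m \<le> card {L. L \<subseteq> E `` {v} \<and> Q (attach v (E `` {v}) D L)}"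
  shows "m * card {D. orients D (del_vertex v E) \<and> P D} \<le> card {D. orients D E \<and> Q D}"
proof -
  let ?N = "E `` {v}" let ?O = "{D. orients D (del_vertex v E) \<and> P D}"
  let ?G = "\<lambda>D. {L. L \<subseteq> ?N \<and> Q (attach v ?N D L)}"
  have fN: "finite ?N" using assms(1) by simp
  have fd: "finite (del_vertex v E)" using assms(1) by (rule rev_finite_subset) (auto simp: del_vertex_def)
  have fO: "finite ?O" by (rule finite_orients[OF fd])
  have fG: "finite (?G D)" for D by (rule finite_subset[of _ "Pow ?N"]) (use fN in auto)
  have nD: "(x, v) \<notin> D \<and> (v, x) \<notin> D" if "D \<in> ?O" for D x
    using that by (auto simp: orients_def del_vertex_def)
  have vN: "v \<notin> ?N" using assms(3) by (auto simp: irrefl_def)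
  have "m * card ?O \<le> (\<Sum>D\<in>?O. card (?G D))"
    using sum_mono[of ?O "\<lambda>_. m" "\<lambda>D. card (?G D)"] m by (simp add: mult.commute)
  also have "\<dots> = card (Sigma ?O ?G)" using fO fG by simp
  also have "\<dots> = card ((\<lambda>(D, L). attach v ?N D L) ` Sigma ?O ?G)"
  proof (rule card_image[symmetric], rule inj_onI, clarify)
    fix D L D' L'
    assume a: "orients D (del_vertex v E)" "P D" "L \<subseteq> ?N" "orients D' (del_vertex v E)" "P D'" "L' \<subseteq> ?N"
      "attach v ?N D L = attach v ?N D' L'"
    show "D = D' \<and> L = L'"
      by (rule attach_inj[OF a(7) _ _ vN a(3,6)]) (use a nD[of D] nD[of D'] in auto)
  qed
  also have "\<dots> \<le> card {D. orients D E \<and> Q D}"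
    using orients_attach[OF assms(2,3)]
    by (intro card_mono finite_orients assms(1)) auto
  finally show ?thesis .
qed

lemma rtrancl_mono_set: "A \<subseteq> B \<Longrightarrow> (x, y) \<in> A\<^sup>* \<Longrightarrow> (x, y) \<in> B\<^sup>*"
  using rtrancl_mono by blast

lemma acyclic_if_ranked:
  fixes f :: "'v \<Rightarrow> nat"
  assumes "\<And>x y. (x, y) \<in> D \<Longrightarrow> f x < f y"
  shows "acyclic D"
proof -
  have "wf (inv_image less_than f)" by simp
  moreover have "D \<subseteq> inv_image less_than f" using assms by (auto simp: inv_image_def)
  ultimately show ?thesis using wf_subset wf_acyclic by blast
qed

text \<open>
  Topological sorting: a sink of the acyclic relation is removed, and receives a rank above all
  others.
\<close>

lemma injective_ranking:
  assumes "finite V" "finite D" "acyclic D"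
  shows "\<exists>f :: 'v \<Rightarrow> nat. inj_on f V \<and> (\<forall>x\<in>V. \<forall>y\<in>V. (x, y) \<in> D \<longrightarrow> f x < f y)"
  using assms(1)
proof (induction "card V" arbitrary: V)
  case 0
  then show ?case by auto
next
  case (Suc n)
  have "wf (D\<inverse>)" using assms(2,3) by (rule finite_acyclic_wf_converse)
  moreover have "V \<noteq> {}" using Suc by auto
  ultimately obtain m where m: "m \<in> V" "\<And>y. (y, m) \<in> D\<inverse> \<Longrightarrow> y \<notin> V"
    using wfE_min[of "D\<inverse>" _ V] by (metis ex_in_conv)
  have "card (V - {m}) = n" using Suc m by simp
  then obtain f :: "'v \<Rightarrow> nat" where f: "inj_on f (V - {m})"
    "\<And>x y. x \<in> V - {m} \<Longrightarrow> y \<in> V - {m} \<Longrightarrow> (x, y) \<in> D \<Longrightarrow> f x < f y"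
    using Suc(1)[of "V - {m}"] Suc(3) by blast
  define g where "g = f(m := Suc (Max (f ` V)))"
  have lt: "f x < Suc (Max (f ` V))" if "x \<in> V" for x
    using that Suc(3) by (simp add: le_imp_less_Suc)
  have "inj_on g V"
    using f(1) lt unfolding g_def inj_on_def by (auto split: if_splits) (metis less_irrefl)+
  moreover have "g x < g y" if "x \<in> V" "y \<in> V" "(x, y) \<in> D" for x y
    using that f(2)[of x y] lt[of x] m(2)[of y] by (auto simp: g_def)
  ultimately show ?case by blast
qed

text \<open>
  Rank the old vertices injectively along \<open>D\<close>. For every threshold, orienting the edges from
  neighbours of \<open>v\<close> below it towards \<open>v\<close>, and the others away from \<open>v\<close>, creates no cycle. The
  neighbours lie at \<open>card N\<close> different ranks, so that \<open>card N + 1\<close> different sets of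
  in-neighbours arise.
\<close>

lemma acyclic_attach_count:
  assumes D: "orients D (del_vertex v E)" "acyclic D" and E: "finite E" "irrefl E"
  shows "card (E `` {v}) + 1 \<le> card {L. L \<subseteq> E `` {v} \<and> acyclic (attach v (E `` {v}) D L)}"
proof -
  let ?N = "E `` {v}"
  have fN: "finite ?N" using E by simp
  have "finite D" 
    using D(1) by (intro finite_subset[OF _ E(1)]) (auto simp: orients_def del_vertex_def)
  then obtain f :: "'a \<Rightarrow> nat" where f: "inj_on f (Field E)"
    "\<And>x y. x \<in> Field E \<Longrightarrow> y \<in> Field E \<Longrightarrow> (x, y) \<in> D \<Longrightarrow> f x < f y"
    using injective_ranking[OF _ _ D(2), of "Field E"] E(1) finite_Field by metis
  have DF: "x \<in> Field E \<and> y \<in> Field E \<and> x \<noteq> v \<and> y \<noteq> v" if "(x, y) \<in> D" for x y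
    using that D(1) by (auto simp: orients_def del_vertex_def Field_def)
  have NF: "?N \<subseteq> Field E" by (auto simp: Field_def)
  have vN: "v \<notin> ?N" using E(2) by (auto simp: irrefl_def)
  let ?below = "\<lambda>t. {x \<in> ?N. f x < t}"
  have ac: "acyclic (attach v ?N D (?below t))" for t
  proof (rule acyclic_if_ranked)
    \<comment> \<open>Old vertices get odd ranks, so that \<open>v\<close> fits strictly between them.\<close>
    fix x y assume "(x, y) \<in> attach v ?N D (?below t)"
    then show "(if x = v then 2 * t else 2 * f x + 1) < (if y = v then 2 * t else 2 * f y + 1)"
      using f(2) DF[of x y] vN by (auto simp: attach_def)
  qed
  have inj: "inj_on (\<lambda>n. ?below (f n)) ?N"
  proof (rule inj_onI)
    fix m n assume mn: "m \<in> ?N" "n \<in> ?N" "?below (f m) = ?below (f n)"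
    then have "f m = f n" by (metis (mono_tags, lifting) less_irrefl linorder_neqE_nat mem_Collect_eq)
    then show "m = n" using f(1) mn NF by (auto simp: inj_on_def)
  qed
  have "?N \<notin> (\<lambda>n. ?below (f n)) ` ?N" by auto
  then have c: "card (insert ?N ((\<lambda>n. ?below (f n)) ` ?N)) = card ?N + 1"
    using fN inj by (simp add: card_image)
  have "\<exists>t. ?N = ?below t"
    by (rule exI[of _ "Suc (Max (f ` ?N))"]) (use fN in \<open>auto simp: less_Suc_eq_le\<close>)
  then obtain t where t: "?N = ?below t" by blast
  have "acyclic (attach v ?N D ?N)" using ac[of t] unfolding t[symmetric] .
  then have "card (insert ?N ((\<lambda>n. ?below (f n)) ` ?N)) \<le> card {L. L \<subseteq> ?N \<and> acyclic (attach v ?N D L)}"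
    using ac fN by (intro card_mono) auto
  then show ?thesis using c by simp
qed

lemma acyclic_count_vertex:
  assumes "finite E" "sym E" "irrefl E"
  shows "(card (E `` {v}) + 1) * acyclic_count (del_vertex v E) \<le> acyclic_count E"
  unfolding acyclic_count_def by (rule attach_count) (use assms acyclic_attach_count in auto)

text \<open>
  Every set of in-neighbours works unless it makes \<open>v\<close> a source or a sink.
\<close>

lemma strong_count_vertex:
  assumes E: "simple_edges (insert v V) E" and "v \<notin> V"
  shows "(2 ^ card (E `` {v}) - 2) * strong_count V (del_vertex v E) \<le> strong_count (insert v V) E"
  unfolding strong_count_def
proof (rule attach_count)
  let ?N = "E `` {v}"
  show "finite E" "sym E" "irrefl E" using simple_edgesD[OF E] by auto
  have fN: "finite ?N" using \<open>finite E\<close> by simp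
  have vN: "v \<notin> ?N" using \<open>irrefl E\<close> by (auto simp: irrefl_def)
  have NV: "?N \<subseteq> V" using vN simple_edgesD(2)[OF E] by auto
  fix D assume D: "orients D (del_vertex v E)" "strong_on V D"
  have "strong_on (insert v V) (attach v ?N D L)" if L: "L \<subseteq> ?N" "L \<noteq> {}" "L \<noteq> ?N" for L
  proof -
    let ?R = "attach v ?N D L"
    have VV: "(x, y) \<in> ?R\<^sup>*" if "x \<in> V" "y \<in> V" for x y
      using D(2) that rtrancl_mono[of D ?R] by (auto simp: strong_on_def attach_def)
    obtain l m where lm: "l \<in> L" "m \<in> ?N - L" using L by blast
    then have "(l, v) \<in> ?R" "(v, m) \<in> ?R" "l \<in> V" "m \<in> V" using L NV by (auto simp: attach_def)
    then have "(x, v) \<in> ?R\<^sup>*" "(v, x) \<in> ?R\<^sup>*" if "x \<in> V" for x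
      using VV that by (meson rtrancl_into_rtrancl converse_rtrancl_into_rtrancl)+
    with VV show ?thesis by (auto simp: strong_on_def)
  qed
  then have "Pow ?N - {{}, ?N} \<subseteq> {L. L \<subseteq> ?N \<and> strong_on (insert v V) (attach v ?N D L)}"
    by auto
  then have "card (Pow ?N - {{}, ?N}) \<le> card {L. L \<subseteq> ?N \<and> strong_on (insert v V) (attach v ?N D L)}"
    by (rule card_mono[rotated]) (use fN in auto)
  moreover have "card (Pow ?N) - card {{}, ?N} \<le> card (Pow ?N - {{}, ?N})"
    by (rule diff_card_le_card_Diff) simp
  moreover have "card {{}, ?N} \<le> 2" by (simp add: card_insert_if)
  ultimately show "2 ^ card ?N - 2 \<le> card {L. L \<subseteq> ?N \<and> strong_on (insert v V) (attach v ?N D L)}"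
    using fN by (simp add: card_Pow)
qed

abbreviation del_edge :: "'v \<Rightarrow> 'v \<Rightarrow> 'v rel \<Rightarrow> 'v rel" where
  "del_edge x y E \<equiv> E - {(x, y), (y, x)}"

text \<open>Strong connectedness survives the addition of an arc, in either direction.\<close>

lemma strong_count_edge:
  assumes E: "simple_edges V E" and xy: "(x, y) \<in> E"
  shows "2 * strong_count V (del_edge x y E) \<le> strong_count V E"
proof -
  let ?O = "{D. orients D (del_edge x y E) \<and> strong_on V D}"
  have fE: "finite E" "sym E" "irrefl E" using simple_edgesD[OF E] by auto
  have yx: "(y, x) \<in> E" "x \<noteq> y" using xy fE by (auto dest: symD simp: irrefl_def)
  have fO: "finite ?O" using fE by (intro finite_orients) auto
  have n: "(x, y) \<notin> D" "(y, x) \<notin> D" if "D \<in> ?O" for D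
    using that by (auto simp: orients_def)
  have ins: "insert e ` ?O \<subseteq> {D. orients D E \<and> strong_on V D}" if "e = (x, y) \<or> e = (y, x)" for e
  proof safe
    fix D assume D: "orients D (del_edge x y E)" "strong_on V D"
    have 1: "D \<union> D\<inverse> = del_edge x y E" "D \<inter> D\<inverse> = {}" using D(1) by (auto simp: orients_def)
    have "insert e D \<union> (insert e D)\<inverse> = (D \<union> D\<inverse>) \<union> {(x, y), (y, x)}" using that by auto
    also have "\<dots> = E" unfolding 1 using xy yx by auto
    finally have "insert e D \<union> (insert e D)\<inverse> = E" .
    moreover have "insert e D \<inter> (insert e D)\<inverse> = {}" 
      using 1(2) n[of D] D that yx(2) by auto
    ultimately show "orients (insert e D) E" by (simp add: orients_def)
    show "strong_on V (insert e D)"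
      using D(2) rtrancl_mono[of D "insert e D"] by (auto simp: strong_on_def)
  qed
  have card: "card (insert e ` ?O) = card ?O" if "e = (x, y) \<or> e = (y, x)" for e
  proof (rule card_image, rule inj_onI)
    fix D D' assume "D \<in> ?O" "D' \<in> ?O" "insert e D = insert e D'"
    moreover from this have "e \<notin> D" "e \<notin> D'" using n[of D] n[of D'] that by auto
    ultimately show "D = D'" by (simp add: insert_ident)
  qed
  have "insert (x, y) ` ?O \<inter> insert (y, x) ` ?O = {}"
  proof -
    have "insert (x, y) D \<noteq> insert (y, x) D'" if "D' \<in> ?O" for D D'
    proof -
      have "(x, y) \<notin> insert (y, x) D'" using n(1)[OF that] yx(2) by simp
      then show ?thesis by (metis insertI1)
    qed
    then show ?thesis by blast
  qed
  then have "2 * card ?O = card (insert (x, y) ` ?O \<union> insert (y, x) ` ?O)"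
    using fO card by (simp add: card_Un_disjoint)
  also have "\<dots> \<le> card {D. orients D E \<and> strong_on V D}"
    using ins fE(1) by (intro card_mono finite_orients) auto
  finally show ?thesis by (simp add: strong_count_def)
qed

section \<open>Spanning trees and edge exchange\<close>

text \<open>
  Trees are symmetric relations that connect \<open>V\<close> and in which every edge is a bridge. This form of
  acyclicity is the one that edge exchanges use directly.
\<close>

definition trees :: "'v set \<Rightarrow> 'v rel \<Rightarrow> 'v rel set" where
  "trees V E = {T. T \<subseteq> E \<and> sym T \<and> V \<times> V \<subseteq> T\<^sup>* \<and>
     (\<forall>x y. (x, y) \<in> T \<longrightarrow> (x, y) \<notin> (del_edge x y T)\<^sup>*)}"

lemma treesD:
  assumes "T \<in> trees V E"
  shows "T \<subseteq> E" "sym T" "x \<in> V \<Longrightarrow> y \<in> V \<Longrightarrow> (x, y) \<in> T\<^sup>*"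
    "(x, y) \<in> T \<Longrightarrow> (x, y) \<notin> (del_edge x y T)\<^sup>*"
  using assms by (auto simp: trees_def)

lemma finite_trees: "finite E \<Longrightarrow> finite {T \<in> trees V E. P T}"
  by (rule finite_subset[of _ "Pow E"]) (auto simp: trees_def)

lemma sym_del_edge: "sym T \<Longrightarrow> sym (del_edge x y T)"
  by (auto simp: sym_def)

lemma rtrancl_symD: "sym F \<Longrightarrow> (x, y) \<in> F\<^sup>* \<Longrightarrow> (y, x) \<in> F\<^sup>*"
  using sym_rtrancl by (metis symD)

lemma tree_split:
  assumes "T \<in> trees V E" "x \<in> V" "z \<in> V"
  shows "(x, z) \<in> (del_edge x y T)\<^sup>* \<or> (y, z) \<in> (del_edge x y T)\<^sup>*"
proof -
  have "(x, z) \<in> T\<^sup>*" using treesD(3)[OF assms] .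
  then show ?thesis
  proof (induction rule: rtrancl_induct)
    case base
    then show ?case by simp
  next
    case (step w z)
    then show ?case
      by (cases "(w, z) \<in> del_edge x y T") (auto intro: rtrancl_into_rtrancl)
  qed
qed

lemma rtrancl_add_edge:
  assumes "(s, t) \<in> (G \<union> {(p, q), (q, p)})\<^sup>*"
  shows "(s, t) \<in> G\<^sup>* \<or> (s, p) \<in> G\<^sup>* \<and> (q, t) \<in> G\<^sup>* \<or> (s, q) \<in> G\<^sup>* \<and> (p, t) \<in> G\<^sup>*"
  using assms
proof (induction rule: rtrancl_induct)
  case base
  then show ?case by simp
next
  case (step w z)
  then consider "(w, z) \<in> G" | "w = p" "z = q" | "w = q" "z = p" by auto
  then show ?case using step.IH by cases (auto intro: rtrancl_into_rtrancl)
qed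

text \<open>
  Deleting the edge \<open>xy\<close> leaves two components, one containing \<open>x\<close> and \<open>p\<close>, the other \<open>y\<close> and
  \<open>q\<close>; the edge \<open>pq\<close> reconnects them. An old edge remains a bridge since a detour around it
  through \<open>pq\<close> would connect the two components without \<open>pq\<close>.
\<close>

lemma tree_exchange:
  assumes T: "T \<in> trees V E" and xy: "(x, y) \<in> T" and "sym E" "(p, q) \<in> E"
    and xp: "(x, p) \<in> (del_edge x y T)\<^sup>*" and yq: "(y, q) \<in> (del_edge x y T)\<^sup>*"
  shows "del_edge x y T \<union> {(p, q), (q, p)} \<in> trees V E"
proof -
  let ?F = "del_edge x y T" let ?T = "?F \<union> {(p, q), (q, p)}"
  note TD = treesD[OF T]
  have sF: "sym ?F" by (rule sym_del_edge[OF TD(2)])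
  have sT: "sym ?T" using sF by (auto simp: sym_def)
  have sep: "(x, y) \<notin> ?F\<^sup>*" by (rule TD(4)[OF xy])
  have npq: "(p, q) \<notin> ?F\<^sup>*" "(q, p) \<notin> ?F\<^sup>*"
    using sep xp yq rtrancl_symD[OF sF] by (meson rtrancl_trans)+
  have FT: "?F\<^sup>* \<subseteq> ?T\<^sup>*" by (rule rtrancl_mono) auto
  have "(x, y) \<in> ?T\<^sup>*"
  proof -
    have "(x, p) \<in> ?T\<^sup>*" "(q, y) \<in> ?T\<^sup>*" using FT xp rtrancl_symD[OF sF yq] by auto
    moreover have "(p, q) \<in> ?T" by simp
    ultimately show ?thesis by (meson rtrancl_into_rtrancl rtrancl_trans)
  qed
  then have "T \<subseteq> ?T\<^sup>*" using rtrancl_symD[OF sT] by auto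
  then have "T\<^sup>* \<subseteq> ?T\<^sup>*" by (rule rtrancl_subset_rtrancl)
  then have conn: "V \<times> V \<subseteq> ?T\<^sup>*" using TD(3) by auto
  have "(s, t) \<notin> (del_edge s t ?T)\<^sup>*" if st: "(s, t) \<in> ?T" for s t
  proof
    assume cyc: "(s, t) \<in> (del_edge s t ?T)\<^sup>*"
    show False
    proof (cases "{s, t} = {p, q}")
      case True
      then have "del_edge s t ?T \<subseteq> ?F" by (auto simp: doubleton_eq_iff)
      then have "(s, t) \<in> ?F\<^sup>*" using cyc by (rule rtrancl_mono_set)
      then show False using True npq by (auto simp: doubleton_eq_iff)
    next
      case False
      then have stF: "(s, t) \<in> ?F" using st by auto
      let ?G = "del_edge s t ?F"
      have "del_edge s t ?T \<subseteq> ?G \<union> {(p, q), (q, p)}" by auto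
      then have "(s, t) \<in> (?G \<union> {(p, q), (q, p)})\<^sup>*" using cyc by (rule rtrancl_mono_set)
      from rtrancl_add_edge[OF this] show False
      proof (elim disjE conjE)
        assume "(s, t) \<in> ?G\<^sup>*"
        then have "(s, t) \<in> (del_edge s t T)\<^sup>*" by (rule rtrancl_mono_set[rotated]) auto
        then show False using TD(4)[of s t] stF by simp
      next
        assume "(s, p) \<in> ?G\<^sup>*" "(q, t) \<in> ?G\<^sup>*"
        then have "(s, p) \<in> ?F\<^sup>*" "(q, t) \<in> ?F\<^sup>*" by (auto intro: rtrancl_mono_set[rotated])
        then have "(p, q) \<in> ?F\<^sup>*" using stF rtrancl_symD[OF sF]
          by (meson rtrancl_into_rtrancl rtrancl_trans)
        then show False using npq by simp
      next
        assume "(s, q) \<in> ?G\<^sup>*" "(p, t) \<in> ?G\<^sup>*"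
        then have "(s, q) \<in> ?F\<^sup>*" "(p, t) \<in> ?F\<^sup>*" by (auto intro: rtrancl_mono_set[rotated])
        then have "(q, p) \<in> ?F\<^sup>*" using stF rtrancl_symD[OF sF]
          by (meson rtrancl_into_rtrancl rtrancl_trans)
        then show False using npq by simp
      qed
    qed
  qed
  moreover have "?T \<subseteq> E" using TD(1) assms(3,4) by (auto dest: symD)
  ultimately show ?thesis using sT conn by (auto simp: trees_def)
qed

text \<open>
  The exchange can be undone: suppose that two forests \<open>F\<close> and \<open>F'\<close>, both separating \<open>x\<close> from \<open>y\<close>,
  become the same tree by adding an edge that starts on the side of \<open>x\<close>. If the two edges
  differed, \<open>F'\<close> would contain \<open>pq\<close> as well as the part of \<open>F\<close> that joins \<open>q\<close> to \<open>y\<close>, and thus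
  connect \<open>x\<close> to \<open>y\<close>. The condition that each forest has both starting points on the side of \<open>x\<close>
  excludes that the two edges lie behind each other on the path from \<open>x\<close> to \<open>y\<close>.
\<close>

lemma crossing_edge_unique:
  assumes sF: "sym F" "sym F'" and sep: "(x, y) \<notin> F\<^sup>*" "(x, y) \<notin> F'\<^sup>*"
    and eq: "F \<union> {(p, q), (q, p)} = F' \<union> {(p', q'), (q', p')}"
    and F: "(x, p) \<in> F\<^sup>*" "(q, y) \<in> F\<^sup>*" "(x, p') \<in> F\<^sup>*"
    and F': "(x, p') \<in> F'\<^sup>*" "(q', y) \<in> F'\<^sup>*" "(x, p) \<in> F'\<^sup>*"
  shows "p = p' \<and> q = q' \<and> F = F'"
proof -
  have nF: "(p, q) \<notin> F" "(q, p) \<notin> F"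
    using sep(1) F rtrancl_symD[OF sF(1)] sF(1)
    by (meson rtrancl_into_rtrancl rtrancl_trans symD)+
  have nF': "(p', q') \<notin> F'" "(q', p') \<notin> F'"
    using sep(2) F' rtrancl_symD[OF sF(2)] sF(2)
    by (meson rtrancl_into_rtrancl rtrancl_trans symD)+
  have same: "(p', q') = (p, q) \<or> (p', q') = (q, p)"
  proof (rule ccontr)
    assume ne: "\<not> ((p', q') = (p, q) \<or> (p', q') = (q, p))"
    then have "(p', q') \<in> F" using eq by blast
    then have xq': "(x, q') \<in> F\<^sup>*" using F(3) by (rule rtrancl_into_rtrancl[rotated])
    have "(z, y) \<in> F'\<^sup>*" if "(z, y) \<in> F\<^sup>*" for z
      using that
    proof (induction rule: converse_rtrancl_induct)
      case base
      then show ?case by simp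
    next
      case (step s t)
      have "(s, y) \<in> F\<^sup>*" using step by (meson converse_rtrancl_into_rtrancl)
      then have "(x, s) \<notin> F\<^sup>*" using sep(1) by (meson rtrancl_trans)
      then have "s \<noteq> p'" "s \<noteq> q'" using F(3) xq' by auto
      then have "(s, t) \<in> F'" using step(1) eq by blast
      then show ?case using step.IH by (rule converse_rtrancl_into_rtrancl)
    qed
    then have "(q, y) \<in> F'\<^sup>*" using F(2) .
    moreover have "(p, q) \<in> F'" using eq ne by blast
    ultimately have "(x, y) \<in> F'\<^sup>*" using F'(3) by (meson rtrancl_into_rtrancl rtrancl_trans)
    then show False using sep(2) by simp
  qed
  moreover have "(x, q) \<notin> F\<^sup>*" using sep(1) F(2) by (meson rtrancl_trans)
  ultimately have "p = p'" "q = q'" using F(3) by auto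
  moreover from this have "F = F'" using eq nF nF' by blast
  ultimately show ?thesis by simp
qed

text \<open>
  Given a tree \<open>T\<close> containing \<open>vu\<close>, a vertex \<open>w\<close> of \<open>W\<close> and a vertex \<open>c\<close> of \<open>C\<close>, delete \<open>vu\<close>. If
  \<open>w\<close> is on the side of \<open>v\<close>, add \<open>uw\<close>; otherwise add \<open>cw\<close>, which reconnects the components because
  \<open>T\<close> ties \<open>c\<close> to \<open>v\<close>. The outcome determines \<open>T\<close> and \<open>w\<close> in both cases: the new edge is the one
  where the path from \<open>v\<close> to \<open>u\<close> enters \<open>u\<close>, respectively leaves \<open>C\<close> for good. Only in the first case is
  \<open>c\<close> lost, so a tree arises at most \<open>card C + 1\<close> times. The set \<open>X\<close> selects the neighbours
  of \<open>v\<close> that are monitored; the exchange changes none of them except \<open>u\<close>.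
\<close>

lemma exchange_count:
  assumes E: "simple_edges V E" and "v \<in> V" "u \<in> V" "u \<noteq> v" "u \<notin> S" "u \<in> X"
    and C: "finite C" "C \<subseteq> insert v S" and CW: "C \<times> W \<subseteq> E" and uW: "{u} \<times> W \<subseteq> E"
    and vW: "v \<notin> W" "v \<in> C \<Longrightarrow> W \<inter> X = {}"
  shows "card W * card C * card {T \<in> trees V E. T `` {v} \<inter> X = insert u S}
    \<le> (card C + 1) * card {T \<in> trees V E. T `` {v} \<inter> X = S}"
proof -
  let ?A = "{T \<in> trees V E. T `` {v} \<inter> X = insert u S}"
  let ?B = "{T \<in> trees V E. T `` {v} \<inter> X = S}"
  note ED = simple_edgesD[OF E]
  have WV: "W \<subseteq> V" using uW ED(2) by auto
  then have fW: "finite W" using ED(1) finite_subset by blast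
  have uW': "u \<notin> W" using uW ED(4) by (auto simp: irrefl_def)
  have uC: "u \<notin> C" using C(2) assms by auto
  \<comment> \<open>The tag \<open>Some c\<close> or \<open>None\<close> records which of the two reconnections was made.\<close>
  define cut where "cut T = del_edge v u T" for T :: "'a rel"
  define \<Phi> where "\<Phi> = (\<lambda>(T, w, c). if (v, w) \<in> (cut T)\<^sup>*
    then (cut T \<union> {(u, w), (w, u)}, Some c) else (cut T \<union> {(c, w), (w, c)}, None))"
  have cut: "sym (cut T)" "(v, u) \<notin> (cut T)\<^sup>*" "(u, v) \<notin> (cut T)\<^sup>*" "(v, u) \<in> T" "(u, v) \<in> T"
    "z \<in> V \<Longrightarrow> (v, z) \<in> (cut T)\<^sup>* \<or> (u, z) \<in> (cut T)\<^sup>*"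
    "c \<in> C \<Longrightarrow> (v, c) \<in> (cut T)\<^sup>*" if "T \<in> ?A" for T z c
  proof -
    have T: "T \<in> trees V E" "T `` {v} \<inter> X = insert u S" using that by auto
    show vu: "(v, u) \<in> T" using T(2) by auto
    then show "(u, v) \<in> T" using treesD(2)[OF T(1)] by (meson symD)
    show s: "sym (cut T)" unfolding cut_def by (rule sym_del_edge[OF treesD(2)[OF T(1)]])
    show n: "(v, u) \<notin> (cut T)\<^sup>*" unfolding cut_def by (rule treesD(4)[OF T(1) vu])
    then show "(u, v) \<notin> (cut T)\<^sup>*" using rtrancl_symD[OF s] by blast
    show "z \<in> V \<Longrightarrow> (v, z) \<in> (cut T)\<^sup>* \<or> (u, z) \<in> (cut T)\<^sup>*"
      unfolding cut_def by (rule tree_split[OF T(1) \<open>v \<in> V\<close>])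
    show "(v, c) \<in> (cut T)\<^sup>*" if "c \<in> C"
    proof (cases "c = v")
      case False
      then have "c \<in> T `` {v} \<inter> X" using T(2) C(2) that by auto
      moreover have "c \<noteq> u" using that uC by auto
      ultimately have "(v, c) \<in> cut T" using False by (auto simp: cut_def)
      then show ?thesis by auto
    qed simp
  qed
  have "\<Phi> ` (?A \<times> W \<times> C) \<subseteq> ?B \<times> insert None (Some ` C)"
  proof clarify
    fix T w c T' r
    assume T: "T \<in> trees V E" "T `` {v} \<inter> X = insert u S" and w: "w \<in> W" and c: "c \<in> C"
      and eq: "(T', r) = \<Phi> (T, w, c)"
    have TA: "T \<in> ?A" using T by simp
    have wc: "w \<noteq> u" "w \<noteq> v" "c \<noteq> u" "w \<in> V" "(c, w) \<in> E" "(w, u) \<in> E"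
      using w c uW' uC vW WV CW uW symD[OF ED(3)] by auto
    show "T' \<in> ?B \<and> r \<in> insert None (Some ` C)"
    proof (cases "(v, w) \<in> (cut T)\<^sup>*")
      case True
      then have r: "T' = cut T \<union> {(w, u), (u, w)}" "r = Some c" using eq by (auto simp: \<Phi>_def)
      have "T' \<in> trees V E" unfolding r cut_def
        by (rule tree_exchange[OF T(1) cut(4)[OF TA] ED(3)]) (use True wc in \<open>auto simp: cut_def\<close>)
      moreover have "T' `` {v} \<inter> X = S"
        using T(2) \<open>u \<notin> S\<close> wc \<open>u \<noteq> v\<close> unfolding r cut_def by auto
      ultimately show ?thesis using r c by simp
    next
      case False
      then have r: "T' = cut T \<union> {(c, w), (w, c)}" "r = None" using eq by (auto simp: \<Phi>_def)
      have "T' \<in> trees V E" unfolding r cut_def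
        by (rule tree_exchange[OF T(1) cut(4)[OF TA] ED(3) wc(5)])
          (use False cut(6)[OF TA wc(4)] cut(7)[OF TA c] in \<open>auto simp: cut_def\<close>)
      moreover have "T' `` {v} \<inter> X = S"
        using T(2) \<open>u \<notin> S\<close> wc \<open>u \<noteq> v\<close> vW c w unfolding r cut_def by auto
      ultimately show ?thesis using r by simp
    qed
  qed
  moreover have "inj_on \<Phi> (?A \<times> W \<times> C)"
  proof (rule inj_onI)
    fix a a' assume a: "a \<in> ?A \<times> W \<times> C" "a' \<in> ?A \<times> W \<times> C" "\<Phi> a = \<Phi> a'"
    obtain T w c where a1: "a = (T, w, c)" by (rule prod_cases3)
    obtain T' w' c' where a2: "a' = (T', w', c')" by (rule prod_cases3)
    have w: "w \<in> W" "w' \<in> W" and c: "c \<in> C" and c': "c' \<in> C" and eq: "\<Phi> (T, w, c) = \<Phi> (T', w', c')"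
      and A: "T \<in> ?A" "T' \<in> ?A" using a unfolding a1 a2 by auto
    note K = cut[OF A(1)] cut[OF A(2)]
    have wV: "w \<in> V" "w' \<in> V" using w WV by auto
    have "w = w' \<and> c = c' \<and> cut T = cut T'"
    proof (cases "(v, w) \<in> (cut T)\<^sup>*")
      case True
      then have "(v, w') \<in> (cut T')\<^sup>*" "c = c'"
        "cut T \<union> {(u, w), (w, u)} = cut T' \<union> {(u, w'), (w', u)}"
        using eq by (auto simp: \<Phi>_def split: if_splits)
      then show ?thesis
        using crossing_edge_unique[OF K(1,8) K(3,10), of u w u w'] True
          rtrancl_symD[OF K(1), of v w] rtrancl_symD[OF K(8), of v w'] by auto
    next
      case False
      then have n: "(v, w') \<notin> (cut T')\<^sup>*"
        "cut T \<union> {(c, w), (w, c)} = cut T' \<union> {(c', w'), (w', c')}"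
        using eq by (auto simp: \<Phi>_def split: if_splits)
      then have "(u, w) \<in> (cut T)\<^sup>*" "(u, w') \<in> (cut T')\<^sup>*"
        using False K(6)[OF wV(1)] K(13)[OF wV(2)] by auto
      then have "(w, u) \<in> (cut T)\<^sup>*" "(w', u) \<in> (cut T')\<^sup>*"
        using rtrancl_symD[OF K(1)] rtrancl_symD[OF K(8)] by auto
      then show ?thesis
        using crossing_edge_unique[OF K(1,8) K(2,9) n(2)] K(7)[OF c] K(7)[OF c'] K(14)[OF c] K(14)[OF c']
        by auto
    qed
    moreover have "T = cut T \<union> {(v, u), (u, v)}" "T' = cut T' \<union> {(v, u), (u, v)}"
      using K(4,5,11,12) by (auto simp: cut_def)
    ultimately show "a = a'" unfolding a1 a2 by metis
  qed
  moreover have "finite (?B \<times> insert None (Some ` C))"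
    using finite_trees[OF ED(5)] C(1) by simp
  ultimately have "card (?A \<times> W \<times> C) \<le> card (?B \<times> insert None (Some ` C))"
    by (intro card_inj_on_le)
  moreover have "card (insert None (Some ` C)) = card C + 1"
    using C(1) by (simp add: card_image)
  ultimately show ?thesis
    by (simp add: card_cartesian_product mult.commute mult.left_commute)
qed

section \<open>The number of spanning trees of a join\<close>

definition tree_count :: "'v set \<Rightarrow> 'v rel \<Rightarrow> nat" where
  "tree_count V E = card (trees V E)"

text \<open>
  The graph on \<open>A \<union> B\<close> is a join of its parts on \<open>A\<close> and on \<open>B\<close>; the edges inside the two sides
  are arbitrary.
\<close>

definition joined :: "'v set \<Rightarrow> 'v set \<Rightarrow> 'v rel \<Rightarrow> bool" where
  "joined A B E \<longleftrightarrow> simple_edges (A \<union> B) E \<and> A \<inter> B = {} \<and> A \<times> B \<subseteq> E"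

lemma joined_commute: "joined A B E \<Longrightarrow> joined B A E"
  by (auto simp: joined_def simple_edges_def Un_commute dest: symD)

lemma joinedD:
  assumes "joined A B E"
  shows "finite A" "finite B" "A \<inter> B = {}" "A \<times> B \<subseteq> E" "B \<times> A \<subseteq> E"
    "simple_edges (A \<union> B) E" "finite E" "sym E" "irrefl E" "E \<subseteq> (A \<union> B) \<times> (A \<union> B)"
  using assms simple_edgesD[of "A \<union> B" E] by (auto simp: joined_def dest: symD)

text \<open>
  Exchange with \<open>S\<close> empty and \<open>C = {x}\<close>. In terms of electrical networks, \<open>c\<close> common neighbours
  bound the effective resistance between \<open>x\<close> and \<open>y\<close> by \<open>2 / c\<close>.
\<close>

lemma tree_count_edge:
  assumes E: "simple_edges V E" and xy: "x \<in> V" "y \<in> V" "x \<noteq> y"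
    and W: "{x, y} \<times> W \<subseteq> E" "W \<noteq> {}" "card W = c"
  shows "real (tree_count V E) \<le> (1 + 2 / c) * real (tree_count V (del_edge x y E))"
proof -
  note ED = simple_edgesD[OF E]
  let ?with = "{T \<in> trees V E. T `` {x} \<inter> {y} = insert y {}}"
  let ?without = "{T \<in> trees V E. T `` {x} \<inter> {y} = {}}"
  have nW: "x \<notin> W" "y \<notin> W" using W ED(4) by (auto simp: irrefl_def)
  have "finite W" using W(1) ED(2) by (intro finite_subset[OF _ ED(1)]) auto
  then have c: "c > 0" using W by auto
  have "c * card {x} * card ?with \<le> (card {x} + 1) * card ?without"
    unfolding W(3)[symmetric]
    by (rule exchange_count[OF E]) (use xy W(1) nW in auto)
  then have 1: "real c * card ?with \<le> 2 * card ?without" by (simp flip: of_nat_mult)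
  have "?without = trees V (del_edge x y E)"
    using treesD(2) by (auto simp: trees_def dest: symD)
  moreover have dj: "?with \<inter> ?without = {}" by auto
  moreover have "trees V E = ?with \<union> ?without" by auto
  then have "tree_count V E = card ?with + card ?without"
    unfolding tree_count_def
    using card_Un_disjoint[OF finite_trees[OF ED(5)] finite_trees[OF ED(5)] dj] by (rule trans[OF arg_cong])
  ultimately show ?thesis using 1 c by (simp add: tree_count_def field_simps)
qed

lemma sum_Pow_insert:
  fixes g :: "nat \<Rightarrow> real"
  assumes "finite N" "u \<notin> N"
  shows "(\<Sum>S\<in>Pow (insert u N). g (card S)) = (\<Sum>S\<in>Pow N. g (card S)) + (\<Sum>S\<in>Pow N. g (Suc (card S)))"
proof -
  have "(\<Sum>S\<in>insert u ` Pow N. g (card S)) = (\<Sum>S\<in>Pow N. g (card (insert u S)))"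
    by (rule sum.reindex_cong[of "insert u"]) (use assms in \<open>auto simp: inj_on_def\<close>)
  also have "\<dots> = (\<Sum>S\<in>Pow N. g (Suc (card S)))"
  proof (rule sum.cong[OF refl])
    fix S assume "S \<in> Pow N"
    then have "finite S" "u \<notin> S" using assms finite_subset by auto
    then show "g (card (insert u S)) = g (Suc (card S))" by simp
  qed
  finally show ?thesis
    unfolding Pow_insert using assms by (subst sum.union_disjoint) auto
qed

lemma sum_Pow_power:
  fixes x :: real
  assumes "finite N"
  shows "(\<Sum>S\<in>Pow N. x ^ card S) = (1 + x) ^ card N"
  using assms by (induction N) (simp_all add: sum_Pow_insert sum_distrib_left[symmetric] algebra_simps)

text \<open>The derivative of the preceding identity with respect to \<open>x\<close>.\<close>

lemma sum_Pow_power_deriv: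
  fixes x :: real
  assumes "finite N"
  shows "(\<Sum>S\<in>Pow N. card S * x ^ (card S - 1)) = card N * (1 + x) ^ (card N - 1)"
  using assms
proof (induction N)
  case (insert u N)
  have e: "real (Suc s) * x ^ (Suc s - 1) = x * (s * x ^ (s - 1)) + x ^ s" for s :: nat
    by (cases s) (simp_all add: algebra_simps)
  have "(\<Sum>S\<in>Pow (insert u N). card S * x ^ (card S - 1))
      = (\<Sum>S\<in>Pow N. card S * x ^ (card S - 1))
        + (\<Sum>S\<in>Pow N. x * (card S * x ^ (card S - 1)) + x ^ card S)"
    by (simp only: sum_Pow_insert[OF insert(1,2), of "\<lambda>s. s * x ^ (s - 1)"] e)
  also have "\<dots> = card N * (1 + x) ^ (card N - 1) + (x * (card N * (1 + x) ^ (card N - 1)) + (1 + x) ^ card N)"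
    unfolding sum.distrib sum_distrib_left[symmetric] insert.IH sum_Pow_power[OF insert(1)] ..
  also have "\<dots> = card (insert u N) * (1 + x) ^ (card (insert u N) - 1)"
    using insert(1,2) by (cases "card N") (simp_all add: algebra_simps)
  finally show ?case .
qed simp

text \<open>
  The derivative of \<open>x (1 + x)^n\<close>, where \<open>n = card N\<close>, with a power of \<open>1 + x\<close> moved to the
  denominator so that no truncated exponent \<open>n - 1\<close> occurs.
\<close>

lemma sum_Pow_power_Suc:
  fixes x :: real
  assumes "finite N" "x > 0"
  shows "(\<Sum>S\<in>Pow N. (card S + 1) * x ^ card S) = (1 + x) ^ card N * (1 + x + card N * x) / (1 + x)"
proof -
  have e: "real (s + 1) * x ^ s = x * (s * x ^ (s - 1)) + x ^ s" for s :: nat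
    by (cases s) (simp_all add: algebra_simps)
  have "(\<Sum>S\<in>Pow N. (card S + 1) * x ^ card S) = x * (card N * (1 + x) ^ (card N - 1)) + (1 + x) ^ card N"
    unfolding e sum.distrib sum_distrib_left[symmetric] sum_Pow_power_deriv[OF assms(1)]
      sum_Pow_power[OF assms(1)] ..
  also have "\<dots> = (1 + x) ^ card N * (1 + x + card N * x) / (1 + x)"
    using assms(2) by (cases "card N") (simp_all add: field_simps)
  finally show ?thesis .
qed

lemma tree_count_by_neighbours:
  assumes "finite E" "E `` {v} \<inter> X \<subseteq> N" "finite N"
  shows "tree_count V E = (\<Sum>S\<in>Pow N. card {T \<in> trees V E. T `` {v} \<inter> X = S})"
proof -
  have "trees V E = (\<Union>S\<in>Pow N. {T \<in> trees V E. T `` {v} \<inter> X = S})"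
    using assms(2) treesD(1) by fastforce
  then have "tree_count V E = card (\<Union>S\<in>Pow N. {T \<in> trees V E. T `` {v} \<inter> X = S})"
    by (simp add: tree_count_def)
  also have "\<dots> = (\<Sum>S\<in>Pow N. card {T \<in> trees V E. T `` {v} \<inter> X = S})"
    by (rule card_UN_disjoint) (use assms finite_trees in auto)
  finally show ?thesis .
qed

definition del_star :: "'v \<Rightarrow> 'v set \<Rightarrow> 'v rel \<Rightarrow> 'v rel" where
  "del_star v B E = E - {v} \<times> B - B \<times> {v}"

text \<open>
  Exchange with \<open>C = insert v S\<close> and \<open>W = A\<close> shows, one neighbour after the other, that a set \<open>S\<close>
  of neighbours of \<open>v\<close> inside \<open>B\<close> belongs to at most \<open>(card S + 1) / a^(card S)\<close> times as many
  trees as the empty set; the sum over all \<open>S\<close> gives the factor. It is attained if the neighbours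
  of \<open>v\<close> have no further neighbours in \<open>B\<close>.
\<close>

lemma tree_count_del_star:
  assumes J: "joined A B E" and v: "v \<in> B" and a: "card A = a" "A \<noteq> {}"
    and k: "card (E `` {v} \<inter> B) = k"
  shows "real (tree_count (A \<union> B) E)
    \<le> (1 + 1 / a) ^ k * (a + k + 1) / (a + 1) * real (tree_count (A \<union> B) (del_star v B E))"
proof -
  note JD = joinedD[OF J]
  let ?N = "E `` {v} \<inter> B" let ?V = "A \<union> B"
  let ?t = "\<lambda>S. card {T \<in> trees ?V E. T `` {v} \<inter> B = S}"
  have fN: "finite ?N" using JD by simp
  have apos: "a > 0" using a JD by auto
  have vN: "v \<notin> ?N" using JD(9) by (auto simp: irrefl_def)
  have t: "?t S \<le> (card S + 1) * (1 / a) ^ card S * ?t {}" if "S \<subseteq> ?N" for S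
    using finite_subset[OF that fN] that
  proof (induction S)
    case (insert u S)
    then have ih: "?t S \<le> (card S + 1) * (1 / a) ^ card S * ?t {}" by auto
    have vS: "v \<notin> S" using vN insert by auto
    have c: "card (insert v S) = card S + 1" using vS insert by simp
    have "card A * card (insert v S) * ?t (insert u S) \<le> (card (insert v S) + 1) * ?t S"
    proof (rule exchange_count[OF JD(6)])
      show "insert v S \<times> A \<subseteq> E" "{u} \<times> A \<subseteq> E" using insert v JD(5) by auto
      show "u \<noteq> v" using insert vN by auto
    qed (use insert v JD in auto)
    then have "real a * (card S + 1) * ?t (insert u S) \<le> real (card S + 2) * ?t S"
      unfolding c a by (simp flip: of_nat_mult of_nat_add of_nat_Suc)
    also have "\<dots> \<le> real (card S + 2) * ((card S + 1) * (1 / a) ^ card S * ?t {})"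
      using ih by (intro mult_left_mono) auto
    finally have "real (card S + 1) * (a * ?t (insert u S))
      \<le> real (card S + 1) * ((card S + 2) * (1 / a) ^ card S * ?t {})"
      by (simp add: algebra_simps)
    then have "a * ?t (insert u S) \<le> (card S + 2) * (1 / a) ^ card S * ?t {}"
      by (subst (asm) mult_le_cancel_left_pos) auto
    then show ?case using insert apos by (simp add: field_simps)
  qed simp
  have 0: "?t {} = tree_count ?V (del_star v B E)"
  proof -
    have "{T \<in> trees ?V E. T `` {v} \<inter> B = {}} = trees ?V (del_star v B E)"
      using treesD(2) by (auto simp: trees_def del_star_def dest: symD)
    then show ?thesis by (simp add: tree_count_def)
  qed
  have "real (tree_count ?V E) = (\<Sum>S\<in>Pow ?N. real (?t S))"
    using tree_count_by_neighbours[OF JD(7) _ fN, of v B ?V] by simp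
  also have "\<dots> \<le> (\<Sum>S\<in>Pow ?N. (card S + 1) * (1 / a) ^ card S * ?t {})"
    by (intro sum_mono t) auto
  also have "\<dots> = (1 + 1 / a) ^ k * (1 + 1 / a + k * (1 / a)) / (1 + 1 / a) * ?t {}"
    unfolding sum_distrib_right[symmetric] using sum_Pow_power_Suc[OF fN, of "1 / a"] apos k by simp
  also have "1 + 1 / real a + k * (1 / a) = (a + k + 1) / a" using apos by (simp add: field_simps)
  also have "(1 + 1 / real a) ^ k * ((a + k + 1) / a) / (1 + 1 / a)
      = (1 + 1 / a) ^ k * (a + k + 1) / (a + 1)"
    using apos by (simp add: divide_simps)
  finally show ?thesis unfolding 0 by (simp add: add_ac)
qed

lemma tree_del_leaf:
  assumes T: "T \<in> trees (insert v V) E" "T `` {v} = {x}" and E: "simple_edges (insert v V) E" and "v \<notin> V"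
  shows "del_vertex v T \<in> trees V (del_vertex v E)" "T = del_vertex v T \<union> {(v, x), (x, v)}"
proof -
  note TD = treesD[OF T(1)] and ED = simple_edgesD[OF E]
  have vx: "(v, x) \<in> T" "(x, v) \<in> T" using T(2) TD(2) by (auto dest: symD)
  have nx: "w = x" if "(v, w) \<in> T \<or> (w, v) \<in> T" for w using that T(2) TD(2) by (auto dest: symD)
  have xv: "x \<noteq> v" using vx TD(1) ED(4) by (auto simp: irrefl_def)
  show "T = del_vertex v T \<union> {(v, x), (x, v)}" using vx nx by (auto simp: del_vertex_def)
  have "(y, z) \<in> (del_vertex v T)\<^sup>*" if yz: "y \<in> V" "z \<in> V" for y z
  proof -
    have "(y, z) \<in> T\<^sup>*" using TD(3) yz by simp
    then have "(z \<noteq> v \<longrightarrow> (y, z) \<in> (del_vertex v T)\<^sup>*) \<and> (z = v \<longrightarrow> (y, x) \<in> (del_vertex v T)\<^sup>*)"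
    proof (induction rule: rtrancl_induct)
      case base
      then show ?case using yz \<open>v \<notin> V\<close> by auto
    next
      case (step w z)
      show ?case
      proof (cases "w = v \<or> z = v")
        case True
        then show ?thesis using step nx xv by auto
      next
        case False
        then have "(w, z) \<in> del_vertex v T" using step by (auto simp: del_vertex_def)
        then show ?thesis using step False by (auto intro: rtrancl_into_rtrancl)
      qed
    qed
    then show ?thesis using yz \<open>v \<notin> V\<close> by auto
  qed
  moreover have "(s, t) \<notin> (del_edge s t (del_vertex v T))\<^sup>*" if "(s, t) \<in> del_vertex v T" for s t
  proof
    assume "(s, t) \<in> (del_edge s t (del_vertex v T))\<^sup>*"
    then have "(s, t) \<in> (del_edge s t T)\<^sup>*" by (rule rtrancl_mono_set[rotated]) (auto simp: del_vertex_def)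
    then show False using TD(4)[of s t] that by (auto simp: del_vertex_def)
  qed
  ultimately show "del_vertex v T \<in> trees V (del_vertex v E)"
    using TD(1,2) by (auto simp: trees_def del_vertex_def sym_def)
qed

text \<open>
  Here \<open>v\<close> is adjacent to \<open>A\<close> only. Trees in which \<open>v\<close> is a leaf at a given vertex of \<open>A\<close>
  correspond to trees without \<open>v\<close>. Exchange with \<open>C = S\<close> and \<open>W = B\<close> extends this to an arbitrary
  nonempty neighbourhood \<open>S\<close>, which belongs to at most \<open>card S / b^(card S - 1)\<close> times as many
  trees. For complete bipartite graphs the resulting factor is exact.
\<close>

lemma tree_count_cross_vertex:
  assumes J: "joined A (insert v B) E" and v: "v \<notin> B" and nb: "E `` {v} = A"
    and a: "card A = a" "A \<noteq> {}" and b: "card B = b" "B \<noteq> {}"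
  shows "real (tree_count (A \<union> insert v B) E)
    \<le> a * (1 + 1 / b) ^ (a - 1) * real (tree_count (A \<union> B) (del_vertex v E))"
proof -
  note JD = joinedD[OF J]
  let ?V = "A \<union> insert v B"
  let ?t = "\<lambda>S. card {T \<in> trees ?V E. T `` {v} \<inter> UNIV = S}"
  let ?n = "tree_count (A \<union> B) (del_vertex v E)"
  have bpos: "b > 0" using b JD by auto
  have vA: "v \<notin> A" using JD by auto
  have V: "?V = insert v (A \<union> B)" "v \<notin> A \<union> B" using v vA by auto
  have E: "simple_edges (insert v (A \<union> B)) E" using JD(6) V by simp
  have t: "?t S \<le> card S * (1 / b) ^ (card S - 1) * ?n" if "S \<noteq> {}" "S \<subseteq> A" for S
    using finite_subset[OF that(2) JD(1)] that
  proof (induction S rule: finite_ne_induct)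
    case (singleton x)
    have "card {T \<in> trees ?V E. T `` {v} \<inter> UNIV = {x}} \<le> card (trees (A \<union> B) (del_vertex v E))"
    proof (rule card_inj_on_le[of "del_vertex v"])
      show "inj_on (del_vertex v) {T \<in> trees ?V E. T `` {v} \<inter> UNIV = {x}}"
      proof (rule inj_onI)
        fix T T' assume "T \<in> {T \<in> trees ?V E. T `` {v} \<inter> UNIV = {x}}"
          "T' \<in> {T \<in> trees ?V E. T `` {v} \<inter> UNIV = {x}}" "del_vertex v T = del_vertex v T'"
        then show "T = T'" using tree_del_leaf(2)[OF _ _ E V(2)] V(1)
          by (metis (mono_tags, lifting) Int_UNIV_right mem_Collect_eq)
      qed
      show "del_vertex v ` {T \<in> trees ?V E. T `` {v} \<inter> UNIV = {x}} \<subseteq> trees (A \<union> B) (del_vertex v E)"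
        using tree_del_leaf(1)[OF _ _ E V(2)] V(1) by auto
      have "finite (del_vertex v E)" by (rule finite_subset[OF _ JD(7)]) (auto simp: del_vertex_def)
      from finite_trees[OF this, of "A \<union> B" "\<lambda>_. True"]
      show "finite (trees (A \<union> B) (del_vertex v E))" by simp
    qed
    then show ?case by (simp add: tree_count_def)
  next
    case (insert u S)
    then have ih: "?t S \<le> card S * (1 / b) ^ (card S - 1) * ?n" by auto
    have s: "card S > 0" using insert by (simp add: card_gt_0_iff)
    have "card B * card S * ?t (insert u S) \<le> (card S + 1) * ?t S"
    proof (rule exchange_count[OF JD(6)])
      show "S \<times> B \<subseteq> E" "{u} \<times> B \<subseteq> E" using insert JD(4) by auto
      show "u \<noteq> v" using insert vA by auto
    qed (use insert v vA JD in auto)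
    then have "real b * card S * ?t (insert u S) \<le> real (card S + 1) * ?t S"
      unfolding b by (simp flip: of_nat_mult of_nat_add of_nat_Suc)
    also have "\<dots> \<le> real (card S + 1) * (card S * (1 / b) ^ (card S - 1) * ?n)"
      using ih by (intro mult_left_mono) auto
    finally have "real (card S) * (b * ?t (insert u S))
      \<le> real (card S) * ((card S + 1) * (1 / b) ^ (card S - 1) * ?n)"
      by (simp add: algebra_simps)
    then have "b * ?t (insert u S) \<le> (card S + 1) * (1 / b) ^ (card S - 1) * ?n"
      using s by (subst (asm) mult_le_cancel_left_pos) auto
    moreover have "(1 / real b) ^ card S = (1 / b) * (1 / b) ^ (card S - 1)"
      using s by (simp flip: power_Suc)
    ultimately show ?case using insert bpos by (simp add: field_simps)
  qed
  have t0: "?t {} = 0"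
  proof -
    have "T `` {v} \<noteq> {}" if T: "T \<in> trees ?V E" for T
    proof -
      obtain w where w: "w \<in> A" "w \<noteq> v" using a(2) vA by auto
      then have "(v, w) \<in> T\<^sup>*" using treesD(3)[OF T] by auto
      then show ?thesis using w(2) by (auto elim: converse_rtranclE)
    qed
    then have "{T \<in> trees ?V E. T `` {v} \<inter> UNIV = {}} = {}" by auto
    then show ?thesis by (simp only: card.empty)
  qed
  have "real (tree_count ?V E) = (\<Sum>S\<in>Pow A. real (?t S))"
    using tree_count_by_neighbours[OF JD(7) _ JD(1), of v UNIV ?V] nb by simp
  also have "\<dots> \<le> (\<Sum>S\<in>Pow A. card S * (1 / b) ^ (card S - 1) * ?n)"
  proof (rule sum_mono)
    fix S assume "S \<in> Pow A"
    then show "real (?t S) \<le> card S * (1 / b) ^ (card S - 1) * ?n"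
      using t[of S] t0 by (cases "S = {}") (simp_all del: Int_UNIV_right)
  qed
  also have "\<dots> = a * (1 + 1 / b) ^ (a - 1) * ?n"
    unfolding sum_distrib_right[symmetric] using sum_Pow_power_deriv[OF JD(1), of "1 / b"] a by simp
  finally show ?thesis .
qed

section \<open>Adding a vertex to a join\<close>

lemma joined_del:
  assumes J: "joined A (insert v B) E" and v: "v \<notin> B"
  shows "joined A B (del_vertex v E)"
proof -
  have "v \<notin> A" using joinedD(3)[OF J] by auto
  then show ?thesis
    using joinedD[OF J] v by (auto simp: joined_def simple_edges_def del_vertex_def sym_def irrefl_def)
qed

lemma card_neighbours:
  assumes J: "joined A (insert v B) E" and v: "v \<notin> B"
  shows "card (E `` {v}) = card A + card (E `` {v} \<inter> B)"
proof -
  note JD = joinedD[OF J]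
  have "E `` {v} = A \<union> (E `` {v} \<inter> B)"
    using JD(5,9,10) by (auto simp: irrefl_def)
  moreover have "A \<inter> (E `` {v} \<inter> B) = {}" using JD(3) by auto
  ultimately show ?thesis using JD(1,2) by (metis card_Un_disjoint finite_Int finite_insert)
qed

lemma acyclic_count_joined_vertex:
  assumes J: "joined A (insert v B) E" and v: "v \<notin> B"
    and m: "card A + card (E `` {v} \<inter> B) + 1 = m"
  shows "m * acyclic_count (del_vertex v E) \<le> acyclic_count E"
proof -
  have "card (E `` {v}) + 1 = m" using card_neighbours[OF J v] m by simp
  then show ?thesis using acyclic_count_vertex[OF joinedD(7-9)[OF J], of v] by simp
qed

lemma strong_count_joined_vertex:
  assumes J: "joined A (insert v B) E" and v: "v \<notin> B"
    and k: "card (E `` {v} \<inter> B) = k" and a: "card A = a"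
  shows "(2 ^ (a + k) - 2) * strong_count (A \<union> B) (del_vertex v E) \<le> strong_count (A \<union> insert v B) E"
proof -
  have "v \<notin> A" using joinedD(3)[OF J] by auto
  then show ?thesis
    using strong_count_vertex[of v "A \<union> B" E] joinedD(6)[OF J] card_neighbours[OF J v] k a v by simp
qed

lemma joined_del_star:
  assumes J: "joined A B E" and "v \<in> B"
  shows "joined A B (del_star v B E)"
  using joinedD[OF J] assms(2)
  by (auto simp: joined_def simple_edges_def del_star_def sym_def irrefl_def)

text \<open>
  The edges from \<open>v\<close> to its own side are removed before \<open>v\<close> itself.
\<close>

lemma tree_count_joined_vertex:
  assumes J: "joined A (insert v B) E" and v: "v \<notin> B"
    and k: "card (E `` {v} \<inter> B) = k" and a: "card A = a" "A \<noteq> {}" and b: "card B = b" "B \<noteq> {}"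
  shows "real (tree_count (A \<union> insert v B) E)
    \<le> (1 + 1 / a) ^ k * real (a + k + 1) * (a / real (a + 1)) * (1 + 1 / b) ^ (a - 1)
       * real (tree_count (A \<union> B) (del_vertex v E))"
proof -
  note JD = joinedD[OF J]
  let ?E = "del_star v (insert v B) E"
  have vv: "(v, v) \<notin> E" using JD(9) by (auto simp: irrefl_def)
  have nb: "?E `` {v} = A"
    using JD(3,5,10) vv by (auto simp: del_star_def)
  have dd: "del_vertex v ?E = del_vertex v E" by (auto simp: del_star_def del_vertex_def)
  have k': "card (E `` {v} \<inter> insert v B) = k"
    using k vv by (simp add: Int_insert_right)
  have "real (tree_count (A \<union> insert v B) E)
    \<le> (1 + 1 / a) ^ k * real (a + k + 1) / real (a + 1) * real (tree_count (A \<union> insert v B) ?E)"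
    using tree_count_del_star[OF J insertI1 a k'] by (simp add: add_ac)
  also have "\<dots> \<le> (1 + 1 / a) ^ k * real (a + k + 1) / real (a + 1) *
      (a * (1 + 1 / b) ^ (a - 1) * real (tree_count (A \<union> B) (del_vertex v ?E)))"
    by (intro mult_left_mono tree_count_cross_vertex[OF joined_del_star[OF J insertI1] v nb a b]) auto
  finally show ?thesis unfolding dd by (simp add: field_simps)
qed

text \<open>
  The case \<open>a = 3\<close> of the next lemma. The left-hand side grows by the factor
  \<open>16/9 (k + 5) / (k + 4)\<close> from \<open>k\<close> to \<open>k + 1\<close>, which is at most \<open>2\<close> only from \<open>k = 4\<close> on, so that the induction starts there.
\<close>

lemma power_three_bound: "(16 / 9 :: real) ^ k * (k + 4) * 6 \<le> (2 ^ (3 + k) - 2) * 4"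
proof -
  have large: "(16 / 9 :: real) ^ (4 + m) * (real (4 + m) + 4) * 6 \<le> (2 ^ (3 + (4 + m)) - 2) * 4" for m
  proof (induction m)
    case (Suc m)
    have "(16 / 9 :: real) ^ (4 + Suc m) * (real (4 + Suc m) + 4) * 6
      = (16 / 9 :: real) ^ (4 + m) * 6 * (16 / 9 * (real m + 9))"
      by (simp only: add_Suc_right power_Suc) (simp add: algebra_simps)
    also have "\<dots> \<le> (16 / 9 :: real) ^ (4 + m) * 6 * (2 * (real m + 8))"
      by (intro mult_left_mono) auto
    also have "\<dots> = 2 * ((16 / 9 :: real) ^ (4 + m) * (real (4 + m) + 4) * 6)" by (simp add: algebra_simps)
    also have "\<dots> \<le> 2 * ((2 ^ (3 + (4 + m)) - 2) * 4)" using Suc by simp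
    also have "\<dots> \<le> (2 ^ (3 + (4 + Suc m)) - 2) * 4" by (simp add: power_add)
    finally show ?case .
  qed (simp add: power_divide)
  consider "k = 0" | "k = 1" | "k = 2" | "k = 3" | m where "k = 4 + m"
    using le_Suc_ex[of 4 k] by fastforce
  then show ?thesis using large by cases (simp_all add: power_divide)
qed

text \<open>
  There is equality for \<open>k = 0\<close>. From \<open>k\<close> to \<open>k + 1\<close> the right-hand side at least doubles, whereas
  for \<open>a \<ge> 4\<close> the left-hand side grows at most by \<open>(5/4)^2 \<cdot> 6/5 < 2\<close>.
\<close>

lemma power_degree_bound:
  fixes a k :: nat
  assumes "3 \<le> a"
  shows "(2 ^ a - 2) * (1 + 1 / a) ^ (2 * k) * (a + k + 1) \<le> (2 ^ (a + k) - 2) * real (a + 1)"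
proof (cases "a = 3")
  case True
  have "(1 + 1 / real 3) ^ (2 * k) = (16 / 9) ^ k" by (simp add: power_mult power2_eq_square)
  then show ?thesis using True power_three_bound[of k] by (simp add: algebra_simps)
next
  case False
  then have a: "a \<ge> 4" using assms by simp
  show ?thesis
  proof (induction k)
    case (Suc k)
    have p: "(2 :: real) ^ a - 2 \<ge> 0" using power_increasing[of 1 a "2 :: real"] assms by simp
    have q: "(1 + 1 / a)\<^sup>2 * (a + k + 2) \<le> 2 * (real (a + k + 1))"
    proof -
      have "1 + 1 / real a \<le> 5 / 4" using a by (simp add: field_simps)
      then have "(1 + 1 / a)\<^sup>2 \<le> (5 / 4 :: real)\<^sup>2" by (intro power_mono) auto
      then have "(1 + 1 / a)\<^sup>2 * (a + k + 2) \<le> (5 / 4 :: real)\<^sup>2 * (a + k + 2)"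
        by (intro mult_right_mono) auto
      also have "\<dots> \<le> 2 * (real (a + k + 1))" using a by (simp add: power2_eq_square)
      finally show ?thesis .
    qed
    have pw: "(1 + 1 / real a) ^ (2 * Suc k) = (1 + 1 / a) ^ (2 * k) * (1 + 1 / a)\<^sup>2"
      by (simp add: power2_eq_square)
    have "(2 ^ a - 2) * (1 + 1 / a) ^ (2 * Suc k) * (a + Suc k + 1)
        = (2 ^ a - 2) * (1 + 1 / a) ^ (2 * k) * ((1 + 1 / a)\<^sup>2 * (a + k + 2))"
      unfolding pw by (simp add: mult_ac add_ac)
    also have "\<dots> \<le> (2 ^ a - 2) * (1 + 1 / a) ^ (2 * k) * (2 * (real (a + k + 1)))"
      by (intro mult_left_mono q) (use p in auto)
    also have "\<dots> = 2 * ((2 ^ a - 2) * (1 + 1 / a) ^ (2 * k) * (a + k + 1))" by simp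
    also have "\<dots> \<le> 2 * ((2 ^ (a + k) - 2) * real (a + 1))" using Suc by simp
    also have "\<dots> \<le> (2 ^ (a + Suc k) - 2) * real (a + 1)" by (simp add: algebra_simps)
    finally show ?case .
  qed simp
qed

text \<open>
  The inequality \<open>Q \<ge> r\<close> with the denominator cleared, so that it composes without knowing that
  spanning trees exist.
\<close>

definition ratio_ge :: "'v set \<Rightarrow> 'v rel \<Rightarrow> real \<Rightarrow> bool" where
  "ratio_ge V E r \<longleftrightarrow> r * (real (tree_count V E))\<^sup>2 \<le> real (acyclic_count E) * real (strong_count V E)"

lemma ratio_ge_joined_vertex:
  assumes J: "joined A (insert v B) E" and v: "v \<notin> B"
    and a: "card A = a" "3 \<le> a" and b: "card B = b" "B \<noteq> {}"
    and IH: "ratio_ge (A \<union> B) (del_vertex v E) r" and r: "0 \<le> r"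
  shows "ratio_ge (A \<union> insert v B) E (r * lambda_const a * (b / (b + 1)) ^ (2 * a - 2))"
proof -
  define k where "k = card (E `` {v} \<inter> B)"
  define c where "c = (1 + 1 / real a) ^ k * real (a + k + 1) * (a / real (a + 1)) * (1 + 1 / b) ^ (a - 1)"
  let ?t = "real (tree_count (A \<union> insert v B) E)" let ?t' = "real (tree_count (A \<union> B) (del_vertex v E))"
  have A: "A \<noteq> {}" using a by auto
  have bpos: "b > 0" using b joinedD(2)[OF J] by auto
  have p: "(2 :: real) ^ a - 2 \<ge> 0" using power_increasing[of 1 a "2 :: real"] a by simp
  have t: "?t \<le> c * ?t'"
    unfolding c_def by (rule tree_count_joined_vertex[OF J v k_def[symmetric] a(1) A b])
  have beta: "(b / (b + 1)) ^ (2 * a - 2) * ((1 + 1 / real b) ^ (a - 1))\<^sup>2 = 1"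
  proof -
    have e: "2 * a - 2 = (a - 1) * 2" by simp
    have "(b / (b + 1)) ^ (2 * a - 2) * ((1 + 1 / real b) ^ (a - 1))\<^sup>2
        = ((b / (b + 1)) * (1 + 1 / real b)) ^ (2 * a - 2)"
      unfolding e power_mult power_mult_distrib ..
    also have "(b / (b + 1)) * (1 + 1 / real b) = 1"
    proof -
      have "1 + 1 / real b = (b + 1) / b" using bpos by (simp add: field_simps)
      then show ?thesis using bpos by simp
    qed
    finally show ?thesis by simp
  qed
  \<comment> \<open>The factors depending on \<open>b\<close> cancel; what remains is \<open>power_degree_bound\<close>.\<close>
  have c2: "lambda_const a * (b / (b + 1)) ^ (2 * a - 2) * c\<^sup>2 \<le> real (a + k + 1) * (2 ^ (a + k) - 2)"
  proof -
    have "lambda_const a * (b / (b + 1)) ^ (2 * a - 2) * c\<^sup>2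
      = lambda_const a * ((1 + 1 / real a) ^ k * real (a + k + 1) * (a / real (a + 1)))\<^sup>2
        * ((b / (b + 1)) ^ (2 * a - 2) * ((1 + 1 / real b) ^ (a - 1))\<^sup>2)"
      unfolding c_def power_mult_distrib by (simp only: mult_ac)
    also have "\<dots> = lambda_const a * ((1 + 1 / real a) ^ k * real (a + k + 1) * (a / real (a + 1)))\<^sup>2"
      unfolding beta by simp
    also have "\<dots> = (a + k + 1) * ((2 ^ a - 2) * (1 + 1 / a) ^ (2 * k) * (a + k + 1)) / (a + 1)"
    proof -
      have "(x + 1) * z / x\<^sup>2 * (p * n * (x / (x + 1)))\<^sup>2 = n * (z * p\<^sup>2 * n) / (x + 1)"
        if "x > 0" for x z p n :: real
        using that by (simp add: divide_simps power2_eq_square)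
      from this[of "real a" "2 ^ a - 2" "(1 + 1 / real a) ^ k" "real (a + k + 1)"]
      show ?thesis using a(2) by (simp add: lambda_const_def power_even_eq add_ac)
    qed
    also have "\<dots> \<le> (a + k + 1) * ((2 ^ (a + k) - 2) * real (a + 1)) / (a + 1)"
      by (intro divide_right_mono mult_left_mono power_degree_bound a(2)) auto
    also have "\<dots> = real (a + k + 1) * (2 ^ (a + k) - 2)" by simp
    finally show ?thesis .
  qed
  have pk: "(2 :: real) ^ (a + k) - 2 \<ge> 0" using power_increasing[of 1 "a + k" "2 :: real"] a by simp
  have l: "lambda_const a \<ge> 0" using p by (auto simp: lambda_const_def)
  have s: "((2 :: real) ^ (a + k) - 2) * strong_count (A \<union> B) (del_vertex v E) \<le> strong_count (A \<union> insert v B) E"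
  proof -
    have "(2 :: nat) \<le> 2 ^ (a + k)" using power_increasing[of 1 "a + k" "2 :: nat"] a by simp
    then have "(2 :: real) ^ (a + k) - 2 = real (2 ^ (a + k) - 2)" by (simp add: of_nat_diff)
    then show ?thesis
      using of_nat_mono[OF strong_count_joined_vertex[OF J v k_def[symmetric] a(1)], where 'a = real]
      by (simp only: of_nat_mult)
  qed
  have ac: "real (a + k + 1) * acyclic_count (del_vertex v E) \<le> acyclic_count E"
    using of_nat_mono[OF acyclic_count_joined_vertex[OF J v, of "a + k + 1"], where 'a = real] a(1)
    by (simp only: of_nat_mult k_def)
  have "r * lambda_const a * (b / (b + 1)) ^ (2 * a - 2) * ?t\<^sup>2
    \<le> r * lambda_const a * (b / (b + 1)) ^ (2 * a - 2) * (c * ?t')\<^sup>2"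
    using t l r by (intro mult_left_mono power_mono) auto
  also have "\<dots> = (lambda_const a * (b / (b + 1)) ^ (2 * a - 2) * c\<^sup>2) * (r * ?t'\<^sup>2)"
    by (simp add: power_mult_distrib mult_ac)
  also have "\<dots> \<le> (real (a + k + 1) * (2 ^ (a + k) - 2)) * (acyclic_count (del_vertex v E) * strong_count (A \<union> B) (del_vertex v E))"
    using IH r pk by (intro mult_mono c2) (auto simp: ratio_ge_def)
  also have "\<dots> = (real (a + k + 1) * acyclic_count (del_vertex v E)) * (((2 :: real) ^ (a + k) - 2) * strong_count (A \<union> B) (del_vertex v E))"
    by (simp add: mult_ac)
  also have "\<dots> \<le> real (acyclic_count E) * strong_count (A \<union> insert v B) E"
    using pk by (intro mult_mono ac s) auto
  finally show ?thesis by (simp add: ratio_ge_def add_ac)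
qed

section \<open>Growing a join from two sides of equal order\<close>

lemma D_const_Suc:
  assumes "3 \<le> a"
  shows "D_const (Suc a) = D_const a * (lambda_const a * lambda_const (Suc a) * (real a / real (Suc a)) ^ (4 * a - 2))"
  unfolding D_const_def prod.atLeastLessThan_Suc[OF assms] unfolding Suc_eq_plus1 mult.assoc ..

lemma lambda_const_nonneg: "1 \<le> a \<Longrightarrow> 0 \<le> lambda_const a"
  using power_increasing[of 1 a "2 :: real"] by (simp add: lambda_const_def)

lemma D_const_nonneg: "0 \<le> D_const a"
  unfolding D_const_def by (intro mult_nonneg_nonneg prod_nonneg ballI lambda_const_nonneg) auto

lemma ratio_ge_grow:
  assumes ab: "3 \<le> a" "a \<le> b"
    and base: "\<And>A B E :: 'v rel. joined A B E \<Longrightarrow> card A = a \<Longrightarrow> card B = a \<Longrightarrow> ratio_ge (A \<union> B) E (D_const a)"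
    and J: "joined A B (E :: 'v rel)" "card A = a" "card B = b"
  shows "ratio_ge (A \<union> B) E (D_const a * lambda_const a ^ (b - a) * (a / b) ^ (2 * a - 2))"
  using ab(2) J
proof (induction b arbitrary: A B E rule: dec_induct)
  case base
  then show ?case using assms(3)[of A B E] ab by simp
next
  case (step b)
  obtain v where v: "v \<in> B" using step by fastforce
  define B' where "B' = B - {v}"
  have B: "B = insert v B'" "v \<notin> B'" using v by (auto simp: B'_def)
  have J: "joined A (insert v B') E" using step B by simp
  have cB: "card B' = b" using step B joinedD(2)[OF step.prems(1)] by simp
  have ne: "B' \<noteq> {}" using cB step(1) ab by auto
  have IH: "ratio_ge (A \<union> B') (del_vertex v E) (D_const a * lambda_const a ^ (b - a) * (a / b) ^ (2 * a - 2))"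
    using step.IH[OF joined_del[OF J B(2)]] step.prems cB by simp
  have nn: "0 \<le> D_const a * lambda_const a ^ (b - a) * (a / b) ^ (2 * a - 2)"
    using D_const_nonneg lambda_const_nonneg[of a] ab by simp
  have "(a / b) ^ (2 * a - 2) * (b / (b + 1)) ^ (2 * a - 2) = (a / (b + 1 :: real)) ^ (2 * a - 2)"
    unfolding power_mult_distrib[symmetric] using step(1) ab by simp
  then have e: "D_const a * lambda_const a ^ (b - a) * (a / b) ^ (2 * a - 2) * lambda_const a * (b / (real b + 1)) ^ (2 * a - 2)
    = D_const a * lambda_const a ^ (Suc b - a) * (a / Suc b) ^ (2 * a - 2)"
    using step(1) by (simp add: Suc_diff_le mult_ac add_ac)
  show ?case
    using ratio_ge_joined_vertex[OF J B(2) step.prems(2) ab(1) cB ne IH nn] unfolding e B(1) .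
qed

text \<open>
  From order \<open>a\<close> to order \<open>a + 1\<close> on both sides: the second side grows first, by
  \<open>ratio_ge_grow\<close>, and then the first side grows with the roles of the two sides exchanged. The
  exponents \<open>2a - 2\<close> and \<open>2a\<close> of the two steps add up to \<open>4a - 2\<close>.
\<close>

lemma ratio_ge_diagonal:
  assumes a: "3 \<le> a"
    and base: "\<And>A B E :: 'v rel. joined A B E \<Longrightarrow> card A = 3 \<Longrightarrow> card B = 3 \<Longrightarrow> ratio_ge (A \<union> B) E (34 / 15)"
    and J: "joined A B (E :: 'v rel)" "card A = a" "card B = a"
  shows "ratio_ge (A \<union> B) E (D_const a)"
  using a J
proof (induction a arbitrary: A B E rule: dec_induct)
  case base
  then show ?case using assms(2)[of A B E] by (simp add: D_const_def)
next
  case (step a)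
  obtain v where v: "v \<in> A" using step by fastforce
  define A' where "A' = A - {v}"
  have A: "A = insert v A'" "v \<notin> A'" using v by (auto simp: A'_def)
  have J: "joined B (insert v A') E" using joined_commute step A by metis
  have cA: "card A' = a" using step A joinedD(1)[OF step.prems(1)] by simp
  have ne: "A' \<noteq> {}" using cA step(1) by auto
  have J': "joined A' B (del_vertex v E)" using joined_commute joined_del[OF J A(2)] by metis
  define r where "r = D_const a * lambda_const a ^ (Suc a - a) * (a / Suc a) ^ (2 * a - 2)"
  have IH: "ratio_ge (B \<union> A') (del_vertex v E) r"
    unfolding r_def Un_commute[of B A']
    by (rule ratio_ge_grow[OF step(1) le_SucI[OF le_refl] _ J' cA step.prems(3)]) (rule step.IH)
  have nn: "0 \<le> r" using D_const_nonneg lambda_const_nonneg[of a] step(1) by (simp add: r_def)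
  have e: "4 * a - 2 = (2 * a - 2) + (2 * Suc a - 2)" using step(1) by simp
  have "r * lambda_const (Suc a) * (a / (a + 1)) ^ (2 * Suc a - 2) = D_const (Suc a)"
    unfolding D_const_Suc[OF step(1)] e power_add r_def by (simp add: mult_ac add_ac)
  then show ?case
    using ratio_ge_joined_vertex[OF J A(2) step.prems(3) _ cA ne IH nn] A step(1) by (simp add: Un_commute add_ac)
qed

section \<open>Complete bipartite graphs\<close>

definition biclique :: "'v set \<Rightarrow> 'v set \<Rightarrow> 'v rel" where
  "biclique A B = A \<times> B \<union> B \<times> A"

lemma biclique_commute: "biclique A B = biclique B A"
  by (auto simp: biclique_def)

lemma joined_biclique: "finite A \<Longrightarrow> finite B \<Longrightarrow> A \<inter> B = {} \<Longrightarrow> joined A B (biclique A B)"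
  by (auto simp: joined_def simple_edges_def biclique_def sym_def irrefl_def)

lemma del_biclique: "v \<notin> A \<Longrightarrow> v \<notin> B \<Longrightarrow> del_vertex v (biclique A (insert v B)) = biclique A B"
  by (auto simp: del_vertex_def biclique_def)

lemma biclique_neighbours: "v \<notin> A \<Longrightarrow> biclique A (insert v B) `` {v} = A"
  by (auto simp: biclique_def)

lemma tree_count_biclique_vertex:
  assumes "finite A" "finite B" "A \<inter> insert v B = {}" "v \<notin> B" "card A = a" "card B = b" "A \<noteq> {}" "B \<noteq> {}"
  shows "real (tree_count (A \<union> insert v B) (biclique A (insert v B)))
    \<le> a * (1 + 1 / b) ^ (a - 1) * real (tree_count (A \<union> B) (biclique A B))"
proof -
  have "joined A (insert v B) (biclique A (insert v B))" using assms by (intro joined_biclique) auto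
  moreover have "v \<notin> A" using assms(3) by auto
  ultimately show ?thesis
    using tree_count_cross_vertex[of A v B "biclique A (insert v B)" a b] biclique_neighbours[of v A B]
      del_biclique[of v A B] assms by simp
qed

lemma tree_count_biclique_33:
  assumes "distinct [x, y, z, u, v, w]"
  shows "real (tree_count ({x, y, z} \<union> {u, v, w}) (biclique {x, y, z} {u, v, w})) \<le> 81"
proof -
  let ?n = "\<lambda>A B. real (tree_count (A \<union> B) (biclique A B))"
  have sw: "?n A B = ?n B A" for A B :: "'a set" by (simp add: Un_commute biclique_commute)
  have d: "x \<noteq> y" "x \<noteq> z" "x \<noteq> u" "x \<noteq> v" "x \<noteq> w" "y \<noteq> z" "y \<noteq> u" "y \<noteq> v" "y \<noteq> w"
    "z \<noteq> u" "z \<noteq> v" "z \<noteq> w" "u \<noteq> v" "u \<noteq> w" "v \<noteq> w" using assms by auto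
  note d = d d[symmetric]
  have 1: "?n {x, y, z} {u, v, w} \<le> 3 * (1 + 1 / 2) ^ 2 * ?n {x, y, z} {v, w}"
    using tree_count_biclique_vertex[of "{x, y, z}" "{v, w}" u 3 2] d by simp
  have 2: "?n {v, w} {x, y, z} \<le> 2 * (1 + 1 / 2) * ?n {v, w} {y, z}"
    using tree_count_biclique_vertex[of "{v, w}" "{y, z}" x 2 2] d by simp
  have 3: "?n {y, z} {v, w} \<le> 2 * (1 + 1 / 1) * ?n {y, z} {w}"
    using tree_count_biclique_vertex[of "{y, z}" "{w}" v 2 1] d by simp
  have 4: "?n {w} {y, z} \<le> 1 * ?n {w} {z}"
    using tree_count_biclique_vertex[of "{w}" "{z}" y 1 1] d by simp
  have 5: "?n {w} {z} \<le> 1"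
  proof -
    have "T = {(w, z), (z, w)}" if T: "T \<in> trees ({w} \<union> {z}) (biclique {w} {z})" for T
    proof -
      have "(w, z) \<in> T\<^sup>*" using treesD(3)[OF T] by simp
      then obtain q where "(w, q) \<in> T" using d by (metis converse_rtranclE)
      then have "(w, z) \<in> T" "(z, w) \<in> T" using treesD(1,2)[OF T] d by (auto simp: biclique_def dest: symD)
      then show ?thesis using treesD(1)[OF T] by (auto simp: biclique_def)
    qed
    then have "trees ({w} \<union> {z}) (biclique {w} {z}) \<subseteq> {{(w, z), (z, w)}}" by blast
    then have "card (trees ({w} \<union> {z}) (biclique {w} {z})) \<le> card {{(w, z), (z, w)}}"
      by (rule card_mono[rotated]) simp
    then show ?thesis by (simp add: tree_count_def)
  qed
  show ?thesis using 1 2 3 4 5 unfolding sw[of "{v, w}"] sw[of "{w}" "{y, z}"]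
    by (simp add: power2_eq_square)
qed

text \<open>
  An orientation of \<open>K_{2,n}\<close> assigns to each vertex of \<open>B\<close> its set of in-neighbours in \<open>{x, y}\<close>.
  It has a cycle only if there are directed paths of length two from \<open>x\<close> to \<open>y\<close> and from \<open>y\<close> to
  \<open>x\<close>, that is, if both \<open>{x}\<close> and \<open>{y}\<close> are assigned; inclusion-exclusion counts the assignments
  that avoid one of them.
\<close>

lemma acyclic_count_biclique_2:
  assumes "x \<noteq> y" "x \<notin> B" "y \<notin> B" "finite B"
  shows "2 * 3 ^ card B \<le> acyclic_count (biclique {x, y} B) + 2 ^ card B"
proof -
  let ?D = "\<lambda>g. {(s, j). j \<in> B \<and> s \<in> g j} \<union> {(j, s). j \<in> B \<and> s \<in> {x, y} \<and> s \<notin> g j}"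
  let ?A = "\<lambda>s. B \<rightarrow>\<^sub>E Pow {x, y} - {{s}}"
  have ac: "acyclic ({(s, j). j \<in> B \<and> s \<in> g j} \<union> {(j, s). j \<in> B \<and> s \<in> {p, q} \<and> s \<notin> g j})"
    if g: "g \<in> B \<rightarrow>\<^sub>E Pow {p, q} - {{p}}" and pq: "p \<noteq> q" "p \<notin> B" "q \<notin> B" for g p q
  proof (rule acyclic_if_ranked)
    \<comment> \<open>Without a path \<open>p j q\<close>, all arcs respect the order: sources, \<open>q\<close>, vertices between \<open>q\<close> and
      \<open>p\<close>, \<open>p\<close>, sinks.\<close>
    let ?r = "\<lambda>j. if j = q then 1 else if j = p then 3 else if g j = {} then 0 else if g j = {q} then 2 else (4 :: nat)"
    fix s t assume st: "(s, t) \<in> {(s, j). j \<in> B \<and> s \<in> g j} \<union> {(j, s). j \<in> B \<and> s \<in> {p, q} \<and> s \<notin> g j}"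
    have "g j = {} \<or> g j = {q} \<or> g j = {p, q}" if "j \<in> B" for j
      using PiE_mem[OF g that] by auto
    with st pq show "?r s < ?r t" by fastforce
  qed
  have P: "k \<in> B \<rightarrow>\<^sub>E Pow {x, y}" if "k \<in> ?A x \<union> ?A y" for k
    using that by (elim UnE) (erule subsetD[OF PiE_mono, rotated], blast)+
  have sub: "k j \<subseteq> {x, y}" if "k \<in> ?A x \<union> ?A y" "j \<in> B" for k j
    using PiE_mem[OF P[OF that(1)] that(2)] by blast
  have "card (?A x \<union> ?A y) \<le> acyclic_count (biclique {x, y} B)"
    unfolding acyclic_count_def
  proof (rule card_inj_on_le[of ?D])
    show "inj_on ?D (?A x \<union> ?A y)"
    proof (rule inj_onI)
      fix g h assume gh: "g \<in> ?A x \<union> ?A y" "h \<in> ?A x \<union> ?A y" "?D g = ?D h"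
      have D: "k j = {s. (s, j) \<in> ?D k}" if k: "k \<in> ?A x \<union> ?A y" "j \<in> B" for k j
        using sub[OF k] k(2) assms by auto
      show "g = h"
      proof (rule PiE_ext[OF P[OF gh(1)] P[OF gh(2)]])
        fix j assume j: "j \<in> B"
        show "g j = h j" unfolding D[OF gh(1) j] D[OF gh(2) j] gh(3) ..
      qed
    qed
    show "?D ` (?A x \<union> ?A y) \<subseteq> {D. orients D (biclique {x, y} B) \<and> acyclic D}"
    proof clarify
      fix g assume g: "g \<in> ?A x \<union> ?A y"
      have "orients (?D g) (biclique {x, y} B)"
        using sub[OF g] assms by (auto simp: orients_def biclique_def)
      moreover have "acyclic (?D g)"
        using g ac[of g x y] ac[of g y x] assms by (auto simp: insert_commute)
      ultimately show "orients (?D g) (biclique {x, y} B) \<and> acyclic (?D g)" by simp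
    qed
    show "finite {D. orients D (biclique {x, y} B) \<and> acyclic D}"
      using assms by (intro finite_orients) (auto simp: biclique_def)
  qed
  moreover have "card (?A x) + card (?A y) = card (?A x \<union> ?A y) + card (?A x \<inter> ?A y)"
    by (rule card_Un_Int) (use assms in \<open>auto intro!: finite_PiE\<close>)
  moreover have "card (?A x) = 3 ^ card B" "card (?A y) = 3 ^ card B"
    using assms by (simp_all add: card_funcsetE card_Diff_singleton card_Pow)
  moreover have "card (?A x \<inter> ?A y) = 2 ^ card B"
  proof -
    have "(Pow {x, y} - {{x}}) \<inter> (Pow {x, y} - {{y}}) = {{}, {x, y}}"
      using assms by (auto simp: Pow_insert)
    then show ?thesis using assms unfolding PiE_Int by (simp add: card_funcsetE numeral_2_eq_2)
  qed
  ultimately show ?thesis by linarith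
qed

text \<open>
  An orientation of \<open>K_{3,3}\<close> is coded by nine bits: entry \<open>3 i + j\<close> is true if the edge between the
  \<open>i\<close>-th vertex of the first and the \<open>j\<close>-th vertex of the second side points to the second side.
  In the following definition a path of length two leads from vertex \<open>i\<close> to vertex \<open>k\<close> of the
  first side.
\<close>

definition reaches :: "bool list \<Rightarrow> nat \<Rightarrow> nat \<Rightarrow> bool" where
  "reaches bs i k \<longleftrightarrow> list_ex (\<lambda>j. bs ! (3 * i + j) \<and> \<not> bs ! (3 * k + j)) [0..<3]"

text \<open>
  On three vertices, reachability needs at most two such steps. A vertex of the second side is
  covered if it has both an in-neighbour and an out-neighbour.
\<close>

definition strong_code :: "bool list \<Rightarrow> bool" where
  "strong_code bs \<longleftrightarrow>
     list_all (\<lambda>j. list_ex (\<lambda>i. bs ! (3 * i + j)) [0..<3] \<and> list_ex (\<lambda>i. \<not> bs ! (3 * i + j)) [0..<3]) [0..<3] \<and>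
     list_all (\<lambda>i. list_all (\<lambda>k. i = k \<or> reaches bs i k \<or>
       list_ex (\<lambda>l. reaches bs i l \<and> reaches bs l k) [0..<3]) [0..<3]) [0..<3]"

lemma count_strong_codes: "length (filter strong_code (List.n_lists 9 [True, False])) = 102"
  by code_simp

lemma strong_count_biclique_33:
  assumes "distinct [x, y, z, u, v, w]"
  shows "102 \<le> strong_count ({x, y, z} \<union> {u, v, w}) (biclique {x, y, z} {u, v, w})"
proof -
  define xs ys where "xs = [x, y, z]" and "ys = [u, v, w]"
  let ?V = "set xs \<union> set ys" let ?E = "biclique (set xs) (set ys)"
  have d: "distinct xs" "distinct ys" "set xs \<inter> set ys = {}" and l: "length xs = 3" "length ys = 3"
    using assms by (auto simp: xs_def ys_def)
  have ne: "xs ! i \<noteq> ys ! j" if "i < 3" "j < 3" for i j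
    using that d(3) l by (metis disjoint_iff nth_mem)
  define D where "D bs = {(p, q). \<exists>i<3. \<exists>j<3. bs ! (3 * i + j) \<and> p = xs ! i \<and> q = ys ! j
      \<or> \<not> bs ! (3 * i + j) \<and> p = ys ! j \<and> q = xs ! i}" for bs
  have D1: "(xs ! i, ys ! j) \<in> D bs \<longleftrightarrow> bs ! (3 * i + j)" if "i < 3" "j < 3" for bs i j
    using that ne ne[symmetric] d l by (auto simp: D_def nth_eq_iff_index_eq)
  have D2: "(ys ! j, xs ! i) \<in> D bs \<longleftrightarrow> \<not> bs ! (3 * i + j)" if "i < 3" "j < 3" for bs i j
    using that ne ne[symmetric] d l by (auto simp: D_def nth_eq_iff_index_eq)
  let ?codes = "set (filter strong_code (List.n_lists 9 [True, False]))"
  have ori: "orients (D bs) ?E" for bs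
  proof -
    have "D bs \<union> (D bs)\<inverse> = ?E"
    proof
      show "D bs \<union> (D bs)\<inverse> \<subseteq> ?E" using l by (auto simp: D_def biclique_def)
      have "(p, q) \<in> D bs \<union> (D bs)\<inverse> \<and> (q, p) \<in> D bs \<union> (D bs)\<inverse>" if pq: "p \<in> set xs" "q \<in> set ys" for p q
      proof -
        obtain i j where "i < 3" "p = xs ! i" "j < 3" "q = ys ! j" using pq l by (metis in_set_conv_nth)
        then show ?thesis using D1[of i j bs] D2[of i j bs] by (cases "bs ! (3 * i + j)") auto
      qed
      then show "?E \<subseteq> D bs \<union> (D bs)\<inverse>" by (auto simp: biclique_def)
    qed
    moreover have "(q, p) \<notin> D bs" if pq: "(p, q) \<in> D bs" for p q
    proof -
      from pq obtain i j where "i < 3" "j < 3"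
        "bs ! (3 * i + j) \<and> p = xs ! i \<and> q = ys ! j \<or> \<not> bs ! (3 * i + j) \<and> p = ys ! j \<and> q = xs ! i"
        by (auto simp: D_def)
      then show ?thesis using D1[of i j bs] D2[of i j bs] by auto
    qed
    ultimately show ?thesis by (auto simp: orients_def)
  qed
  have strong: "strong_on ?V (D bs)" if c: "strong_code bs" for bs
  proof -
    have r: "(xs ! i, xs ! k) \<in> (D bs)\<^sup>*" if ik: "reaches bs i k" "i < 3" "k < 3" for i k
    proof -
      obtain j where "j < 3" "bs ! (3 * i + j)" "\<not> bs ! (3 * k + j)"
        using ik(1) by (auto simp: reaches_def list_ex_iff)
      then have "(xs ! i, ys ! j) \<in> D bs" "(ys ! j, xs ! k) \<in> D bs" using D1 D2 ik by auto
      then show ?thesis by (meson r_into_rtrancl rtrancl_into_rtrancl)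
    qed
    have X: "(xs ! i, xs ! k) \<in> (D bs)\<^sup>*" if ik: "i < 3" "k < 3" for i k
    proof -
      have "i = k \<or> reaches bs i k \<or> (\<exists>l<3. reaches bs i l \<and> reaches bs l k)"
        using c ik
        by (simp add: strong_code_def list_all_iff list_ex_iff atLeast0LessThan Ball_def Bex_def)
      then show ?thesis using r ik by (auto intro: rtrancl_trans)
    qed
    have "(\<exists>i<3. (p, xs ! i) \<in> (D bs)\<^sup>*) \<and> (\<exists>i<3. (xs ! i, p) \<in> (D bs)\<^sup>*)" if p: "p \<in> ?V" for p
    proof (cases "p \<in> set xs")
      case True
      then obtain i where "i < 3" "p = xs ! i" using l by (metis in_set_conv_nth)
      then show ?thesis by auto
    next
      case False
      then obtain j where j: "j < 3" "p = ys ! j" using p l by (metis UnE in_set_conv_nth)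
      have "\<exists>i<3. bs ! (3 * i + j)" "\<exists>i<3. \<not> bs ! (3 * i + j)"
        using c j
        by (simp_all add: strong_code_def list_all_iff list_ex_iff atLeast0LessThan Ball_def Bex_def)
      then show ?thesis using D1 D2 j by (meson r_into_rtrancl)
    qed
    then have "(p, q) \<in> (D bs)\<^sup>*" if "p \<in> ?V" "q \<in> ?V" for p q
      using X that by (meson rtrancl_trans)
    then show ?thesis by (auto simp: strong_on_def)
  qed
  have len: "length bs = 9" if "bs \<in> ?codes" for bs
    using that by (auto simp: length_n_lists_elem)
  have "card ?codes = 102"
    using count_strong_codes by (simp add: distinct_card distinct_n_lists del: set_filter)
  moreover have "card ?codes \<le> strong_count ?V ?E"
    unfolding strong_count_def
  proof (rule card_inj_on_le[of D])
    show "inj_on D ?codes"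
    proof (rule inj_onI)
      fix bs cs assume bc: "bs \<in> ?codes" "cs \<in> ?codes" "D bs = D cs"
      show "bs = cs"
      proof (rule nth_equalityI)
        show "length bs = length cs" using len bc by simp
        fix n assume "n < length bs"
        then have n: "n div 3 < 3" "n mod 3 < 3" using len[OF bc(1)] by auto
        have "bs ! (3 * (n div 3) + n mod 3) = cs ! (3 * (n div 3) + n mod 3)"
          using D1[OF n, of bs] D1[OF n, of cs] bc(3) by simp
        then show "bs ! n = cs ! n" by simp
      qed
    qed
    show "D ` ?codes \<subseteq> {D. orients D ?E \<and> strong_on ?V D}" using ori strong by auto
    show "finite {D. orients D ?E \<and> strong_on ?V D}" by (intro finite_orients) (simp add: biclique_def)
  qed
  ultimately show ?thesis by (simp add: xs_def ys_def)
qed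

section \<open>Two sides of three vertices\<close>

text \<open>
  Up to isomorphism a graph on three vertices is determined by its number \<open>i\<close> of edges. The labels
  are chosen so that for \<open>i \<le> 2\<close> all edges contain \<open>z\<close>.
\<close>

definition triangle_part :: "'v rel \<Rightarrow> 'v \<Rightarrow> 'v \<Rightarrow> 'v \<Rightarrow> nat \<Rightarrow> bool" where
  "triangle_part E x y z i \<longleftrightarrow> distinct [x, y, z] \<and> i \<le> 3 \<and>
     ((z, x) \<in> E \<longleftrightarrow> 1 \<le> i) \<and> ((z, y) \<in> E \<longleftrightarrow> 2 \<le> i) \<and> ((x, y) \<in> E \<longleftrightarrow> 3 \<le> i)"

lemma triangle_part_exists:
  assumes "card A = 3" "sym E"
  shows "\<exists>x y z i. A = {x, y, z} \<and> triangle_part E x y z i"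
proof -
  obtain a b c where A: "A = {a, b, c}" "a \<noteq> b" "a \<noteq> c" "b \<noteq> c"
    using assms(1) by (auto simp: card_3_iff)
  have s: "(p, q) \<in> E \<longleftrightarrow> (q, p) \<in> E" for p q using assms(2) by (auto dest: symD)
  have P: "A = {b, c, a}" "A = {c, a, b}" "A = {b, a, c}" "A = {a, c, b}" "A = {c, b, a}" using A by auto
  have t: "triangle_part E x y z 0" if "(z, x) \<notin> E" "(z, y) \<notin> E" "(x, y) \<notin> E" "distinct [x, y, z]" for x y z
    using that by (simp add: triangle_part_def)
  have t1: "triangle_part E x y z 1" if "(z, x) \<in> E" "(z, y) \<notin> E" "(x, y) \<notin> E" "distinct [x, y, z]" for x y z
    using that by (simp add: triangle_part_def)
  have t2: "triangle_part E x y z 2" if "(z, x) \<in> E" "(z, y) \<in> E" "(x, y) \<notin> E" "distinct [x, y, z]" for x y z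
    using that by (simp add: triangle_part_def)
  have t3: "triangle_part E x y z 3" if "(z, x) \<in> E" "(z, y) \<in> E" "(x, y) \<in> E" "distinct [x, y, z]" for x y z
    using that by (simp add: triangle_part_def)
  have dd: "distinct [a, b, c]" "distinct [b, c, a]" "distinct [c, a, b]" "distinct [b, a, c]"
    "distinct [a, c, b]" "distinct [c, b, a]" using A by auto
  note tt = t t1 t2 t3
  show ?thesis
  proof (cases "(a, b) \<in> E"; cases "(a, c) \<in> E"; cases "(b, c) \<in> E")
  qed (use tt dd A(1) P s in meson)+
qed

lemma joined_mono:
  assumes "joined A B E" "E' \<subseteq> E" "sym E'" "A \<times> B \<subseteq> E'"
  shows "joined A B E'"
  using assms by (auto simp: joined_def simple_edges_def irrefl_def)

text \<open>
  The factor by which the \<open>i\<close> edges of one side increase the number of spanning trees when both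
  sides have three vertices: the values are \<open>1\<close>, \<open>5/3\<close>, \<open>8/3\<close> and \<open>4\<close>.
\<close>

definition triangle_factor :: "nat \<Rightarrow> real" where
  "triangle_factor i = (if i = 3 then 4 else (4 / 3) ^ i * (4 + i) / 4)"

lemma strong_count_del_edge_le:
  assumes "simple_edges V E"
  shows "2 ^ of_bool ((x, y) \<in> E) * strong_count V (del_edge x y E) \<le> strong_count V E"
proof (cases "(x, y) \<in> E")
  case True
  then show ?thesis using strong_count_edge[OF assms] by simp
next
  case False
  then have "(y, x) \<notin> E" using simple_edgesD(3)[OF assms] by (auto dest: symD)
  then have "del_edge x y E = E" using False by blast
  then show ?thesis using False by simp
qed

lemma simple_edges_del_edge: "simple_edges V E \<Longrightarrow> simple_edges V (del_edge x y E)"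
  by (auto simp: simple_edges_def irrefl_def sym_def)

lemma strong_count_remove_part:
  assumes E: "simple_edges V E" and A: "A = {x, y, z}" and t: "triangle_part E x y z i"
  shows "2 ^ i * strong_count V (E - A \<times> A) \<le> strong_count V E"
proof -
  note ED = simple_edgesD[OF E]
  define E1 where "E1 = del_edge z x E"
  define E2 where "E2 = del_edge z y E1"
  have d: "x \<noteq> y" "x \<noteq> z" "y \<noteq> z" using t by (auto simp: triangle_part_def)
  have se1: "simple_edges V E1" unfolding E1_def by (rule simple_edges_del_edge[OF E])
  have se2: "simple_edges V E2" unfolding E2_def by (rule simple_edges_del_edge[OF se1])
  have "E - A \<times> A = del_edge x y E2"
    using ED(4) d by (auto simp: E2_def E1_def A irrefl_def)
  then have "2 ^ of_bool ((x, y) \<in> E2) * strong_count V (E - A \<times> A) \<le> strong_count V E2"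
    using strong_count_del_edge_le[OF se2, of x y] by simp
  moreover have "2 ^ of_bool ((z, y) \<in> E1) * strong_count V E2 \<le> strong_count V E1"
    using strong_count_del_edge_le[OF se1, of z y] by (simp add: E2_def)
  moreover have "2 ^ of_bool ((z, x) \<in> E) * strong_count V E1 \<le> strong_count V E"
    using strong_count_del_edge_le[OF E, of z x] by (simp add: E1_def)
  moreover have "(z, y) \<in> E1 \<longleftrightarrow> 2 \<le> i" "(x, y) \<in> E2 \<longleftrightarrow> 3 \<le> i" "(z, x) \<in> E \<longleftrightarrow> 1 \<le> i" "i \<le> 3"
    using t d by (auto simp: triangle_part_def E1_def E2_def)
  moreover from this have "i = 0 \<or> i = 1 \<or> i = 2 \<or> i = 3" by linarith
  ultimately show ?thesis by (elim disjE) simp_all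
qed

lemma tree_count_remove_star:
  assumes J: "joined A B E" and A: "A = {x, y, z}" and t: "triangle_part E x y z i" "i \<le> 2" and "card B = 3"
  shows "real (tree_count (A \<union> B) E) \<le> (4 / 3) ^ i * (4 + i) / 4 * real (tree_count (A \<union> B) (E - A \<times> A))"
proof -
  note JD = joinedD[OF J]
  have d: "x \<noteq> y" "x \<noteq> z" "y \<noteq> z" using t by (auto simp: triangle_part_def)
  have s: "(p, q) \<in> E \<longleftrightarrow> (q, p) \<in> E" for p q using JD(8) by (auto dest: symD)
  have ir: "(p, p) \<notin> E" for p using JD(9) by (auto simp: irrefl_def)
  have xy: "(x, y) \<notin> E" "(y, x) \<notin> E" using t s[of x y] by (auto simp: triangle_part_def)
  have "E - A \<times> A = del_star z A E"
    using ir xy d by (auto simp: del_star_def A)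
  moreover have "card (E `` {z} \<inter> A) = i"
  proof -
    have "E `` {z} \<inter> A = (if 1 \<le> i then {x} else {}) \<union> (if 2 \<le> i then {y} else {})"
      using t ir by (auto simp: A triangle_part_def)
    then show ?thesis using t(2) d by (cases "i = 0"; cases "i = 1") auto
  qed
  moreover have "B \<noteq> {}" "z \<in> A" using assms(5) A by auto
  ultimately show ?thesis
    using tree_count_del_star[OF joined_commute[OF J], of z 3 i] assms(5)
    by (simp add: Un_commute add_ac)
qed

text \<open>
  Up to two edges form a star at \<open>z\<close>. In a triangle the edge \<open>xy\<close> is removed first; it has the four
  common neighbours \<open>z\<close> and \<open>B\<close>, so it costs only a factor \<open>3/2\<close>.
\<close>

lemma tree_count_remove_part:
  assumes J: "joined A B E" and A: "A = {x, y, z}" and t: "triangle_part E x y z i" and B: "card B = 3"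
  shows "real (tree_count (A \<union> B) E) \<le> triangle_factor i * real (tree_count (A \<union> B) (E - A \<times> A))"
proof (cases "i = 3")
  case False
  then have "i \<le> 2" using t by (simp add: triangle_part_def)
  with tree_count_remove_star[OF J A t this B] False show ?thesis by (simp add: triangle_factor_def)
next
  case True
  note JD = joinedD[OF J]
  let ?E = "del_edge x y E"
  have d: "x \<noteq> y" "x \<noteq> z" "y \<noteq> z" using t by (auto simp: triangle_part_def)
  have s: "(p, q) \<in> E \<longleftrightarrow> (q, p) \<in> E" for p q using JD(8) by (auto dest: symD)
  have zB: "z \<notin> B" using JD(3) A by auto
  have e: "(z, x) \<in> E" "(z, y) \<in> E" "(x, y) \<in> E" using t True by (auto simp: triangle_part_def)
  have W: "{x, y} \<times> insert z B \<subseteq> E" using JD(4) A e s by auto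
  have c: "card (insert z B) = 4" using zB B JD(2) by simp
  have 1: "real (tree_count (A \<union> B) E) \<le> (1 + 2 / real 4) * real (tree_count (A \<union> B) ?E)"
    by (rule tree_count_edge[OF JD(6) _ _ d(1) W _ c]) (use A in auto)
  have J': "joined A B ?E"
    by (rule joined_mono[OF J]) (use JD(3,4) sym_del_edge[OF JD(8)] A in auto)
  have t': "triangle_part ?E x y z 2" using e d by (simp add: triangle_part_def)
  have "?E - A \<times> A = E - A \<times> A" using A by auto
  then have "real (tree_count (A \<union> B) ?E) \<le> 8 / 3 * real (tree_count (A \<union> B) (E - A \<times> A))"
    using tree_count_remove_star[OF J' A t' _ B] by (simp add: power2_eq_square)
  with 1 show ?thesis using True by (simp add: triangle_factor_def)
qed

lemma acyclic_count_empty: "acyclic_count {} = 1"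
proof -
  have "{D. orients D ({} :: 'a rel) \<and> acyclic D} = {{}}" by (auto simp: orients_def acyclic_def)
  then show ?thesis by (simp add: acyclic_count_def)
qed

text \<open>
  If both sides have an edge, two such edges span a \<open>K_4\<close> on \<open>{z, x, w, u}\<close>, which has \<open>24\<close> acyclic
  orientations; then \<open>y\<close> and \<open>v\<close> are added.
\<close>

lemma acyclic_count_ge_both:
  assumes J: "joined A B E" and A: "A = {x, y, z}" "triangle_part E x y z i" "1 \<le> i"
    and B: "B = {u, v, w}" "triangle_part E u v w j" "1 \<le> j"
  shows "24 * (2 + i) * (3 + j) \<le> acyclic_count E"
proof -
  note JD = joinedD[OF J]
  have s: "(p, q) \<in> E \<longleftrightarrow> (q, p) \<in> E" for p q using JD(8) by (auto dest: symD)
  have d: "x \<noteq> y" "x \<noteq> z" "y \<noteq> z" "u \<noteq> v" "u \<noteq> w" "v \<noteq> w" using A B by (auto simp: triangle_part_def)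
  have AB: "p \<noteq> q" if "p \<in> A" "q \<in> B" for p q using that JD(3) by auto
  have iA: "(y, z) \<in> E \<longleftrightarrow> 2 \<le> i" "(y, x) \<in> E \<longleftrightarrow> 3 \<le> i" "(x, z) \<in> E" "i \<le> 3"
    using A s by (auto simp: triangle_part_def)
  have jB: "(v, w) \<in> E \<longleftrightarrow> 2 \<le> j" "(v, u) \<in> E \<longleftrightarrow> 3 \<le> j" "(u, w) \<in> E" "j \<le> 3"
    using B s by (auto simp: triangle_part_def)
  have J0: "joined A (insert v {w, u}) E" using J B(1) by (simp add: insert_commute)
  define E1 where "E1 = del_vertex v E"
  have "E `` {v} \<inter> {w, u} = (if 2 \<le> j then {w} else {}) \<union> (if 3 \<le> j then {u} else {})"
    using jB by auto
  then have "card (E `` {v} \<inter> {w, u}) = j - 1" using d B(3) jB(4) by (cases "j = 1"; cases "j = 2") auto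
  then have 1: "(3 + j) * acyclic_count E1 \<le> acyclic_count E"
    unfolding E1_def by (intro acyclic_count_joined_vertex[OF J0]) (use d A B(3) in auto)
  have J1: "joined {w, u} (insert y {z, x}) E1"
    using joined_commute[OF joined_del[OF J0]] d A(1) by (simp add: E1_def insert_commute)
  define E2 where "E2 = del_vertex y E1"
  have E1: "(p, q) \<in> E1 \<longleftrightarrow> (p, q) \<in> E" if "p \<in> A" "q \<in> A" for p q
    using that AB B(1) by (auto simp: E1_def del_vertex_def)
  have "E1 `` {y} \<inter> {z, x} = (if 2 \<le> i then {z} else {}) \<union> (if 3 \<le> i then {x} else {})"
    using iA E1 A(1) by auto
  then have "card (E1 `` {y} \<inter> {z, x}) = i - 1" using d A(3) iA(4) by (cases "i = 1"; cases "i = 2") auto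
  then have 2: "(2 + i) * acyclic_count E2 \<le> acyclic_count E1"
    unfolding E2_def by (intro acyclic_count_joined_vertex[OF J1]) (use d A(3) in auto)
  have J2: "joined {z, x} (insert u {w}) E2"
    using joined_commute[OF joined_del[OF J1]] d by (simp add: E2_def insert_commute)
  have ab: "u \<noteq> y" "w \<noteq> y" "x \<noteq> v" "z \<noteq> v" "x \<noteq> u" "z \<noteq> u" using JD(3) A(1) B(1) by auto
  have uw: "(u, w) \<in> E2" "(x, z) \<in> E2"
    using jB(3) iA(3) d ab by (simp_all add: E2_def E1_def del_vertex_def)
  have "card (E2 `` {u} \<inter> {w}) = 1" using uw by (simp add: Int_insert_right)
  then have 3: "4 * acyclic_count (del_vertex u E2) \<le> acyclic_count E2"
    by (intro acyclic_count_joined_vertex[OF J2]) (use d in auto)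
  have J3: "joined {w} (insert x {z}) (del_vertex u E2)"
    using joined_commute[OF joined_del[OF J2]] d by (simp add: insert_commute)
  have "(x, z) \<in> del_vertex u E2" using uw ab by (simp add: del_vertex_def)
  then have "card (del_vertex u E2 `` {x} \<inter> {z}) = 1" by (simp add: Int_insert_right)
  then have 4: "3 * acyclic_count (del_vertex x (del_vertex u E2)) \<le> acyclic_count (del_vertex u E2)"
    by (intro acyclic_count_joined_vertex[OF J3]) (use d in auto)
  have J4: "joined {z} (insert w {}) (del_vertex x (del_vertex u E2))"
    using joined_commute[OF joined_del[OF J3]] d by simp
  have 5: "2 * acyclic_count (del_vertex w (del_vertex x (del_vertex u E2))) \<le> acyclic_count (del_vertex x (del_vertex u E2))"
    by (intro acyclic_count_joined_vertex[OF J4]) auto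
  have J5: "joined {z} {} (del_vertex w (del_vertex x (del_vertex u E2)))" using joined_del[OF J4] by simp
  have "del_vertex w (del_vertex x (del_vertex u E2)) = {}" using joinedD(9,10)[OF J5] by (auto simp: irrefl_def)
  then have "24 \<le> acyclic_count E2" using 3 4 5 by (simp add: acyclic_count_empty)
  then have "(2 + i) * 24 \<le> (2 + i) * acyclic_count E2" by (rule mult_le_mono2)
  also note 2
  finally have "(3 + j) * ((2 + i) * 24) \<le> (3 + j) * acyclic_count E1" by (rule mult_le_mono2)
  also note 1
  finally show ?thesis by (simp only: mult_ac)
qed

text \<open>
  Without edges inside \<open>B\<close>, and with \<open>x\<close> and \<open>y\<close> not adjacent, the vertex \<open>z\<close> is added to a
  \<open>K_{2,3}\<close>, whose \<open>46\<close> acyclic orientations exceed what adding vertices one by one would give.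
  If \<open>A\<close> is a triangle, three vertices of degree three are added to it, which gives
  \<open>6 \<cdot> 4^3 = 384\<close>, more than the claimed \<open>46 \<cdot> 7\<close>.
\<close>

lemma acyclic_count_ge_one_side:
  assumes J: "joined A B E" and A: "A = {x, y, z}" "triangle_part E x y z i"
    and B: "card B = 3" "E \<inter> B \<times> B = {}"
  shows "46 * (4 + i) \<le> acyclic_count E"
proof (cases "i = 3")
  case False
  note JD = joinedD[OF J]
  have d: "x \<noteq> y" "x \<noteq> z" "y \<noteq> z" using A by (auto simp: triangle_part_def)
  have s: "(p, q) \<in> E \<longleftrightarrow> (q, p) \<in> E" for p q using JD(8) by (auto dest: symD)
  have ir: "(p, p) \<notin> E" for p using JD(9) by (auto simp: irrefl_def)
  have i: "i \<le> 2" "(z, x) \<in> E \<longleftrightarrow> 1 \<le> i" "(z, y) \<in> E \<longleftrightarrow> 2 \<le> i" "(x, y) \<notin> E" "(y, x) \<notin> E"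
    using A(2) False s[of x y] by (auto simp: triangle_part_def)
  have J0: "joined B (insert z {x, y}) E" using joined_commute[OF J] A(1) by (simp add: insert_commute)
  have "E `` {z} \<inter> {x, y} = (if 1 \<le> i then {x} else {}) \<union> (if 2 \<le> i then {y} else {})"
    using i by auto
  then have "card (E `` {z} \<inter> {x, y}) = i" using d i(1) by (cases "i = 0"; cases "i = 1") auto
  then have 1: "(4 + i) * acyclic_count (del_vertex z E) \<le> acyclic_count E"
    by (intro acyclic_count_joined_vertex[OF J0]) (use d B in auto)
  have "del_vertex z E = biclique {x, y} B"
  proof
    show "del_vertex z E \<subseteq> biclique {x, y} B"
      using JD(10) B(2) i ir A(1) by (auto simp: del_vertex_def biclique_def)
    show "biclique {x, y} B \<subseteq> del_vertex z E"
      using JD(3,4,5) d A(1) by (auto simp: del_vertex_def biclique_def)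
  qed
  moreover have "46 \<le> acyclic_count (biclique {x, y} B)"
    using acyclic_count_biclique_2[of x y B] d JD(2,3) A(1) B(1) by auto
  ultimately have "46 \<le> acyclic_count (del_vertex z E)" by simp
  then have "(4 + i) * 46 \<le> (4 + i) * acyclic_count (del_vertex z E)" by (rule mult_le_mono2)
  then show ?thesis using 1 by (simp only: mult.commute[of 46])
next
  case True
  note JD = joinedD[OF J]
  have d: "x \<noteq> y" "x \<noteq> z" "y \<noteq> z" using A by (auto simp: triangle_part_def)
  obtain u v w where B': "B = {u, v, w}" "u \<noteq> v" "u \<noteq> w" "v \<noteq> w" using B(1) by (auto simp: card_3_iff)
  have AB: "p \<noteq> q" if "p \<in> A" "q \<in> B" for p q using that JD(3) by auto
  have cA: "card A = 3" using A(1) d by simp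
  have nB: "(p, q) \<notin> E" if "p \<in> B" "q \<in> B" for p q using B(2) that by auto
  define E1 where "E1 = del_vertex u E"
  define E2 where "E2 = del_vertex v E1"
  define E3 where "E3 = del_vertex w E2"
  have J0: "joined A (insert u {v, w}) E" using J B' by simp
  have J1: "joined A (insert v {w}) E1" using joined_del[OF J0] B' by (simp add: E1_def)
  have J2: "joined A (insert w {}) E2" using joined_del[OF J1] B' by (simp add: E2_def)
  have J3: "joined {} (insert x {y, z}) E3" using joined_commute[OF joined_del[OF J2]] A(1) by (simp add: E3_def)
  have 1: "4 * acyclic_count E1 \<le> acyclic_count E" unfolding E1_def
    by (rule acyclic_count_joined_vertex[OF J0]) (use nB B' cA in auto)
  have 2: "4 * acyclic_count E2 \<le> acyclic_count E1" unfolding E2_def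
    by (rule acyclic_count_joined_vertex[OF J1]) (use nB B' cA in \<open>auto simp: E1_def del_vertex_def\<close>)
  have 3: "4 * acyclic_count E3 \<le> acyclic_count E2" unfolding E3_def
    by (rule acyclic_count_joined_vertex[OF J2]) (use cA in auto)
  have e: "(p, q) \<in> E3 \<longleftrightarrow> (p, q) \<in> E" if "p \<in> A" "q \<in> A" for p q
    using that AB[of p] AB[of q] B'(1) by (auto simp: E1_def E2_def E3_def del_vertex_def)
  have s: "(p, q) \<in> E \<longleftrightarrow> (q, p) \<in> E" for p q using JD(8) by (auto dest: symD)
  have xyz: "(x, y) \<in> E3" "(x, z) \<in> E3" "(y, z) \<in> E3"
    using A True s e by (auto simp: triangle_part_def)
  then have "E3 `` {x} \<inter> {y, z} = {y, z}" by auto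
  then have 4: "3 * acyclic_count (del_vertex x E3) \<le> acyclic_count E3"
    by (intro acyclic_count_joined_vertex[OF J3]) (use d in auto)
  have J4: "joined {} (insert y {z}) (del_vertex x E3)" using joined_del[OF J3] d by simp
  have "del_vertex x E3 `` {y} \<inter> {z} = {z}" using xyz d by (auto simp: del_vertex_def)
  then have 5: "2 * acyclic_count (del_vertex y (del_vertex x E3)) \<le> acyclic_count (del_vertex x E3)"
    by (intro acyclic_count_joined_vertex[OF J4]) (use d in auto)
  have "joined {} {z} (del_vertex y (del_vertex x E3))" using joined_del[OF J4] d by simp
  then have "del_vertex y (del_vertex x E3) = {}" using joinedD(9,10) by (fastforce simp: irrefl_def)
  then have "2 \<le> acyclic_count (del_vertex x E3)" using 5 by (simp add: acyclic_count_empty)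
  then have "6 \<le> acyclic_count E3" using 4 by linarith
  then have "384 \<le> acyclic_count E" using 1 2 3 by linarith
  then show ?thesis using True by simp
qed

lemma triangle_part_cong:
  assumes "triangle_part E x y z i" "\<And>p q. p \<in> {x, y, z} \<Longrightarrow> q \<in> {x, y, z} \<Longrightarrow> (p, q) \<in> E' \<longleftrightarrow> (p, q) \<in> E"
  shows "triangle_part E' x y z i"
  using assms by (simp add: triangle_part_def)

text \<open>
  With \<open>i\<close> and \<open>j\<close> edges in the two sides, \<open>\<tau>\<close> is at most \<open>81\<close> times the two tree factors and \<open>\<alpha>*\<close> is
  at least \<open>102 \<cdot> 2^(i+j)\<close>, so a lower bound for \<open>\<alpha>\<close> suffices in each of the sixteen cases. The
  constant \<open>34/15\<close> is what these estimates give for \<open>i = 1\<close> and \<open>j = 2\<close>, where \<open>\<alpha> \<ge> 360\<close>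
  and \<open>\<tau> \<le> 360\<close>; the other cases leave room.
\<close>

lemma ratio_ge_33:
  assumes J: "joined A B E" and c: "card A = 3" "card B = 3"
  shows "ratio_ge (A \<union> B) E (34 / 15)"
proof -
  note JD = joinedD[OF J]
  obtain x y z i where A: "A = {x, y, z}" "triangle_part E x y z i"
    using triangle_part_exists[OF c(1) JD(8)] by blast
  obtain u v w j where B: "B = {u, v, w}" "triangle_part E u v w j"
    using triangle_part_exists[OF c(2) JD(8)] by blast
  let ?V = "A \<union> B"
  define E1 where "E1 = E - A \<times> A"
  have J1: "joined A B E1"
    unfolding E1_def by (rule joined_mono[OF J]) (use JD(3,4,8) in \<open>auto simp: sym_def\<close>)
  have B1: "triangle_part E1 u v w j"
    by (rule triangle_part_cong[OF B(2)]) (use JD(3) B(1) in \<open>auto simp: E1_def\<close>)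
  have E2: "E1 - B \<times> B = biclique A B"
    unfolding E1_def using JD(3,4,5,10) by (auto simp: biclique_def)
  have dist: "distinct [x, y, z, u, v, w]"
    using A B JD(3) by (auto simp: triangle_part_def)
  have pos: "0 \<le> triangle_factor k" for k by (simp add: triangle_factor_def)
  have t1: "real (tree_count ?V E) \<le> triangle_factor i * real (tree_count ?V E1)"
    unfolding E1_def by (rule tree_count_remove_part[OF J A c(2)])
  have t2: "real (tree_count ?V E1) \<le> triangle_factor j * real (tree_count ?V (biclique A B))"
    using tree_count_remove_part[OF joined_commute[OF J1] B(1) B1 c(1)] E2 by (simp add: Un_commute)
  have t3: "real (tree_count ?V (biclique A B)) \<le> 81" using tree_count_biclique_33[OF dist] A B by simp
  have t: "real (tree_count ?V E) \<le> 81 * triangle_factor i * triangle_factor j"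
  proof -
    have "triangle_factor i * real (tree_count ?V E1) \<le> triangle_factor i * (triangle_factor j * 81)"
      using t2 t3 pos by (meson mult_left_mono order_trans)
    then show ?thesis using t1 by simp
  qed
  have s1: "2 ^ i * strong_count ?V E1 \<le> strong_count ?V E"
    unfolding E1_def by (rule strong_count_remove_part[OF JD(6) A])
  have s2: "2 ^ j * strong_count ?V (biclique A B) \<le> strong_count ?V E1"
    using strong_count_remove_part[OF joinedD(6)[OF J1] B(1) B1] E2 by simp
  have s3: "102 \<le> strong_count ?V (biclique A B)" using strong_count_biclique_33[OF dist] A B by simp
  have s: "2 ^ i * (2 ^ j * 102) \<le> strong_count ?V E"
    using s1 s2 s3 by (meson le_trans mult_le_mono2)
  have ij: "i \<le> 3" "j \<le> 3" using A B by (auto simp: triangle_part_def)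
  have sA: "E \<inter> A \<times> A = {}" if "i = 0"
    using that A JD(8,9) by (auto simp: triangle_part_def irrefl_def dest: symD)
  have sB: "E \<inter> B \<times> B = {}" if "j = 0"
    using that B JD(8,9) by (auto simp: triangle_part_def irrefl_def dest: symD)
  have a1: "24 * (2 + i) * (3 + j) \<le> acyclic_count E" if "1 \<le> i" "1 \<le> j"
    by (rule acyclic_count_ge_both[OF J A that(1) B that(2)])
  have a2: "46 * (4 + i) \<le> acyclic_count E" if "j = 0"
    by (rule acyclic_count_ge_one_side[OF J A c(2) sB[OF that]])
  have a3: "46 * (4 + j) \<le> acyclic_count E" if "i = 0"
    by (rule acyclic_count_ge_one_side[OF joined_commute[OF J] B c(1) sA[OF that]])
  have key: "34 / 15 * (81 * triangle_factor i * triangle_factor j)\<^sup>2 \<le> real n * real (2 ^ i * (2 ^ j * 102))"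
    if n: "1 \<le> i \<Longrightarrow> 1 \<le> j \<Longrightarrow> 24 * (2 + i) * (3 + j) \<le> n"
      "j = 0 \<Longrightarrow> 46 * (4 + i) \<le> n" "i = 0 \<Longrightarrow> 46 * (4 + j) \<le> n" for n
  proof -
    have "i = 0 \<or> i = 1 \<or> i = 2 \<or> i = 3" using ij(1) by linarith
    moreover have "j = 0 \<or> j = 1 \<or> j = 2 \<or> j = 3" using ij(2) by linarith
    ultimately show ?thesis
      using n by (elim disjE; simp add: triangle_factor_def power2_eq_square)
  qed
  have "34 / 15 * (real (tree_count ?V E))\<^sup>2 \<le> 34 / 15 * (81 * triangle_factor i * triangle_factor j)\<^sup>2"
    using t by (intro mult_left_mono power_mono) auto
  also have "\<dots> \<le> real (acyclic_count E) * real (2 ^ i * (2 ^ j * 102))"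
    by (rule key[OF a1 a2 a3])
  also have "\<dots> \<le> real (acyclic_count E) * real (strong_count ?V E)"
    using s by (intro mult_left_mono) (simp_all only: of_nat_le_iff of_nat_0_le_iff)
  finally show ?thesis by (simp add: ratio_ge_def)
qed

section \<open>Orientations and trees as digraphs\<close>

lemma pair_wf_digraphI:
  assumes "E \<subseteq> V \<times> V"
  shows "pair_wf_digraph \<lparr>pverts = V, parcs = E\<rparr>"
  using assms by unfold_locales auto

lemma rtrancl_imp_awalk:
  assumes "(u, v) \<in> D\<^sup>*" "u \<in> V" "D \<subseteq> V \<times> V"
  shows "\<exists>p. pre_digraph.awalk (with_proj \<lparr>pverts = V, parcs = D\<rparr>) u p v"
proof -
  interpret pair_wf_digraph "\<lparr>pverts = V, parcs = D\<rparr>" by (rule pair_wf_digraphI[OF assms(3)])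
  show ?thesis
    using assms(1)
  proof (induction rule: rtrancl_induct)
    case base
    have "awalk u [] u" using assms(2) by (simp add: awalk_Nil_iff)
    then show ?case by blast
  next
    case (step w z)
    then obtain p where p: "awalk u p w" by blast
    have "awalk w [(w, z)] z" using step(2) assms(3) by (auto simp: awalk_def)
    with p have "awalk u (p @ [(w, z)]) z" by (rule awalk_appendI)
    then show ?case by blast
  qed
qed

lemma awalk_imp_rtrancl:
  assumes "pcas u p v" "set p \<subseteq> D"
  shows "(u, v) \<in> D\<^sup>*"
  using assms by (induction p arbitrary: u) (auto intro: converse_rtrancl_into_rtrancl)

lemma arc_on_cycle:
  assumes "(x, y) \<in> D" "(y, x) \<in> F\<^sup>*" "F \<subseteq> D" "D \<subseteq> V \<times> V"
  shows "\<exists>p. pre_digraph.cycle (with_proj \<lparr>pverts = V, parcs = D\<rparr>) ((x, y) # p) \<and> set p \<subseteq> F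
    \<and> pcas y p x"
proof -
  interpret F: pair_wf_digraph "\<lparr>pverts = V, parcs = F\<rparr>" by (rule pair_wf_digraphI) (use assms in auto)
  interpret D: pair_wf_digraph "\<lparr>pverts = V, parcs = D\<rparr>" by (rule pair_wf_digraphI) (use assms in auto)
  have xy: "x \<in> V" "y \<in> V" using assms by auto
  obtain q where "F.awalk y q x" using rtrancl_imp_awalk[of y x F V] assms xy by auto
  then have p: "F.apath y (F.awalk_to_apath q) x" by (rule F.apath_awalk_to_apath)
  let ?p = "F.awalk_to_apath q"
  have s: "set ?p \<subseteq> F" "pcas y ?p x" "distinct (pawalk_verts y ?p)"
    using p by (auto simp: F.apath_def F.awalk_def)
  have "D.cycle ((x, y) # ?p)"
    unfolding D.cycle_def
    by (rule exI[of _ x]) (use s assms xy in \<open>auto simp: D.awalk_def\<close>)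
  then show ?thesis using s by blast
qed

lemma cycle_first_arc:
  assumes "pre_digraph.cycle (with_proj \<lparr>pverts = V, parcs = D\<rparr>) p"
  obtains x y q where "p = (x, y) # q" "(x, y) \<in> D" "set q \<subseteq> D" "pcas y q x" "distinct (pawalk_verts y q)"
proof -
  interpret D: pair_pre_digraph "\<lparr>pverts = V, parcs = D\<rparr>" .
  from assms obtain u where u: "D.awalk u p u" "distinct (tl (pawalk_verts u p))" "p \<noteq> []"
    unfolding D.cycle_def by auto
  obtain e q where p: "p = e # q" using u(3) by (cases p) auto
  obtain x y where e: "e = (x, y)" by (cases e)
  show thesis
    by (rule that[of x y q]) (use u p e in \<open>auto simp: D.awalk_def\<close>)
qed

lemma finite_pair_digraphs: "finite E \<Longrightarrow> finite {D :: 'a pair_pre_digraph. pverts D = V \<and> parcs D \<subseteq> E}"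
proof -
  assume "finite E"
  have "{D :: 'a pair_pre_digraph. pverts D = V \<and> parcs D \<subseteq> E} \<subseteq> (\<lambda>D. \<lparr>pverts = V, parcs = D\<rparr>) ` Pow E"
  proof
    fix D :: "'a pair_pre_digraph" assume "D \<in> {D. pverts D = V \<and> parcs D \<subseteq> E}"
    then show "D \<in> (\<lambda>D. \<lparr>pverts = V, parcs = D\<rparr>) ` Pow E" by (cases D) auto
  qed
  then show ?thesis using \<open>finite E\<close> by (meson finite_Pow_iff finite_imageI finite_subset)
qed

lemma acyclic_count_le_num_acyclic:
  assumes "finite (parcs G)"
  shows "acyclic_count (parcs G) \<le> num_acyclic G"
  unfolding acyclic_count_def num_acyclic_def
proof (rule card_inj_on_le[of "\<lambda>D. \<lparr>pverts = pverts G, parcs = D\<rparr>"])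
  show "inj_on (\<lambda>D. \<lparr>pverts = pverts G, parcs = D\<rparr>) {D. orients D (parcs G) \<and> acyclic D}"
    by (auto simp: inj_on_def)
  show "(\<lambda>D. \<lparr>pverts = pverts G, parcs = D\<rparr>) ` {D. orients D (parcs G) \<and> acyclic D}
    \<subseteq> {D. acyclic_orientation D G}"
  proof clarify
    fix D assume D: "orients D (parcs G)" "acyclic D"
    have "\<not> pre_digraph.cycle (with_proj \<lparr>pverts = pverts G, parcs = D\<rparr>) p" for p
    proof
      assume "pre_digraph.cycle (with_proj \<lparr>pverts = pverts G, parcs = D\<rparr>) p"
      then obtain x y q where "(x, y) \<in> D" "set q \<subseteq> D" "pcas y q x" by (rule cycle_first_arc)
      then have "(x, x) \<in> D\<^sup>+" using awalk_imp_rtrancl[of y q x D] by (meson rtrancl_into_trancl2)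
      then show False using D(2) by (auto simp: acyclic_def)
    qed
    then show "acyclic_orientation \<lparr>pverts = pverts G, parcs = D\<rparr> G"
      using D(1) by (auto simp: acyclic_orientation_def orientation_def orients_def)
  qed
  show "finite {D. acyclic_orientation D G}"
    by (rule finite_subset[OF _ finite_pair_digraphs[OF assms, of "pverts G"]])
      (auto simp: acyclic_orientation_def orientation_def)
qed

lemma strong_count_le_num_totally_cyclic:
  assumes "finite (parcs G)" "parcs G \<subseteq> pverts G \<times> pverts G"
  shows "strong_count (pverts G) (parcs G) \<le> num_totally_cyclic G"
  unfolding strong_count_def num_totally_cyclic_def
proof (rule card_inj_on_le[of "\<lambda>D. \<lparr>pverts = pverts G, parcs = D\<rparr>"])
  show "inj_on (\<lambda>D. \<lparr>pverts = pverts G, parcs = D\<rparr>) {D. orients D (parcs G) \<and> strong_on (pverts G) D}"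
    by (auto simp: inj_on_def)
  show "(\<lambda>D. \<lparr>pverts = pverts G, parcs = D\<rparr>) ` {D. orients D (parcs G) \<and> strong_on (pverts G) D}
    \<subseteq> {D. totally_cyclic_orientation D G}"
  proof clarify
    fix D assume D: "orients D (parcs G)" "strong_on (pverts G) D"
    have DV: "D \<subseteq> pverts G \<times> pverts G" using D(1) assms(2) by (auto simp: orients_def)
    have "\<exists>p. pre_digraph.cycle (with_proj \<lparr>pverts = pverts G, parcs = D\<rparr>) p \<and> e \<in> set p"
      if e: "e \<in> D" for e
    proof -
      obtain x y where xy: "e = (x, y)" by (cases e)
      have "(y, x) \<in> D\<^sup>*" using D(2) DV e xy by (auto simp: strong_on_def)
      then show ?thesis using arc_on_cycle[of x y D D "pverts G"] e xy DV
        by (metis list.set_intros(1) order_refl)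
    qed
    then show "totally_cyclic_orientation \<lparr>pverts = pverts G, parcs = D\<rparr> G"
      using D(1) by (auto simp: totally_cyclic_orientation_def orientation_def orients_def)
  qed
  show "finite {D. totally_cyclic_orientation D G}"
    by (rule finite_subset[OF _ finite_pair_digraphs[OF assms(1), of "pverts G"]])
      (auto simp: totally_cyclic_orientation_def orientation_def)
qed

lemma connected_symmetric_iff:
  assumes "sym T" "T \<subseteq> V \<times> V"
  shows "Digraph_Component.connected (with_proj \<lparr>pverts = V, parcs = T\<rparr>) \<longleftrightarrow> V \<noteq> {} \<and> V \<times> V \<subseteq> T\<^sup>*"
proof -
  have mk: "mk_symmetric (with_proj \<lparr>pverts = V, parcs = T\<rparr>) = \<lparr>pverts = V, parcs = T\<rparr>"
  proof -
    have "(\<Union>e\<in>T. {(fst e, snd e), (snd e, fst e)}) = T \<union> T\<inverse>" by force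
    also have "\<dots> = T" using assms(1) by (simp add: sym_conv_converse_eq)
    finally show ?thesis
      by (simp only: mk_symmetric_def with_proj_simps pair_pre_digraph.select_convs)
  qed
  interpret T: pair_wf_digraph "\<lparr>pverts = V, parcs = T\<rparr>" by (rule pair_wf_digraphI[OF assms(2)])
  have "reachable (with_proj \<lparr>pverts = V, parcs = T\<rparr>) u v \<longleftrightarrow> (u, v) \<in> T\<^sup>*" if "u \<in> V" "v \<in> V" for u v
  proof
    assume "reachable (with_proj \<lparr>pverts = V, parcs = T\<rparr>) u v"
    then obtain p where "T.awalk u p v" using T.reachable_awalk by auto
    then show "(u, v) \<in> T\<^sup>*" by (intro awalk_imp_rtrancl[of u p v T]) (auto simp: T.awalk_def)
  next
    assume "(u, v) \<in> T\<^sup>*"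
    then show "reachable (with_proj \<lparr>pverts = V, parcs = T\<rparr>) u v"
      using rtrancl_imp_awalk[OF _ that(1) assms(2)] T.reachable_awalk by auto
  qed
  then show ?thesis
    unfolding connected_def mk strongly_connected_def by auto
qed

text \<open>
  In a symmetric digraph an edge \<open>xy\<close> fails to be a bridge exactly if it lies on a cycle of length
  at least three: a path from \<open>y\<close> to \<open>x\<close> avoiding the edge has at least two arcs, and conversely a
  cycle of length at least three visits distinct vertices and so cannot use the edge twice.
\<close>

lemma num_spanning_trees_eq_tree_count:
  assumes E: "simple_edges (pverts G) (parcs G)" and ne: "pverts G \<noteq> {}"
  shows "num_spanning_trees G = tree_count (pverts G) (parcs G)"
proof -
  let ?V = "pverts G" and ?E = "parcs G"
  note ED = simple_edgesD[OF E]
  let ?g = "\<lambda>T. \<lparr>pverts = ?V, parcs = T\<rparr>"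
  have bridges: "(\<exists>p. pre_digraph.cycle (with_proj (?g T)) p \<and> 3 \<le> length p) \<longleftrightarrow>
    (\<exists>x y. (x, y) \<in> T \<and> (x, y) \<in> (del_edge x y T)\<^sup>*)" (is "?L \<longleftrightarrow> ?R")
    if T: "T \<subseteq> ?E" "sym T" for T
  proof
    assume ?L
    then obtain p where p: "pre_digraph.cycle (with_proj (?g T)) p" "3 \<le> length p" by blast
    from p(1) obtain x y q where q: "p = (x, y) # q" "(x, y) \<in> T" "set q \<subseteq> T" "pcas y q x"
      "distinct (pawalk_verts y q)" by (rule cycle_first_arc)
    obtain e f r where r: "q = e # f # r" using p(2) q(1) by (cases q; cases "tl q") auto
    have fst: "fst ` set s \<subseteq> set (pawalk_verts u s)" for s and u :: 'a by (induction s arbitrary: u) auto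
    have lst: "pcas u s x \<Longrightarrow> x \<in> set (pawalk_verts u s)" for s u by (induction s arbitrary: u) auto
    have y: "y \<notin> set (pawalk_verts (snd e) (f # r))" "fst e = y" using q(4,5) r by auto
    have xs: "x \<in> set (pawalk_verts (snd e) (f # r))" using lst q(4) r by auto
    have "set q \<subseteq> del_edge x y T"
    proof
      fix d assume d: "d \<in> set q"
      \<comment> \<open>The reverse arc could only be the first one after \<open>(x, y)\<close>, closing the cycle too early.\<close>
      have "d \<noteq> (y, x)"
      proof
        assume dyx: "d = (y, x)"
        then have "d \<notin> set (f # r)" using fst[of "f # r" "snd e"] y(1) by force
        then have "d = e" using d r by auto
        then have "snd e = x" using dyx by (metis snd_conv)
        then have "pcas x (f # r) x" "distinct (pawalk_verts x (f # r))" using q(4,5) r by auto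
        moreover from this have "fst f = x" "x \<in> set (pawalk_verts (snd f) r)" using lst[of "snd f" r] by auto
        ultimately show False by auto
      qed
      moreover have "d \<noteq> (x, y)"
      proof
        assume dxy: "d = (x, y)"
        have "x \<noteq> y" using q(2) T(1) ED(4) by (auto simp: irrefl_def)
        then have "d \<noteq> e" using dxy y(2) by (metis fst_conv)
        then have df: "d \<in> set (f # r)" using d r by auto
        have snd: "pcas u s x \<Longrightarrow> snd ` set s \<subseteq> set (pawalk_verts u s)" for s u
        proof (induction s arbitrary: u)
          case (Cons a s)
          have "snd a \<in> set (pawalk_verts (snd a) s)" by (cases s) (use Cons in auto)
          then show ?case using Cons by auto
        qed simp
        have "y \<in> set (pawalk_verts (snd e) (f # r))"
          using snd[of "snd e" "f # r"] q(4) r df dxy by force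
        then show False using y(1) by simp
      qed
      ultimately show "d \<in> del_edge x y T" using d q(3) by auto
    qed
    with q(4) have "(y, x) \<in> (del_edge x y T)\<^sup>*" by (rule awalk_imp_rtrancl)
    then show ?R using q(2) rtrancl_symD[OF sym_del_edge[OF T(2)]] by blast
  next
    assume ?R
    then obtain x y where xy: "(x, y) \<in> T" "(x, y) \<in> (del_edge x y T)\<^sup>*" by blast
    have yx: "(y, x) \<in> (del_edge x y T)\<^sup>*" by (rule rtrancl_symD[OF sym_del_edge[OF T(2)] xy(2)])
    have "x \<noteq> y" using xy T(1) ED(4) by (auto simp: irrefl_def)
    obtain p where p: "pre_digraph.cycle (with_proj (?g T)) ((x, y) # p)" "set p \<subseteq> del_edge x y T" "pcas y p x"
      using arc_on_cycle[OF xy(1) yx, of ?V] T(1) ED(2) by auto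
    have "p \<noteq> []" using p(3) \<open>x \<noteq> y\<close> by auto
    moreover have "p \<noteq> [e]" for e using p(2,3) by (cases e) auto
    ultimately have "2 \<le> length p" by (cases p; cases "tl p") auto
    then show ?L using p(1) by (intro exI[of _ "(x, y) # p"]) auto
  qed
  have "bij_betw ?g (trees ?V ?E) {T. undirected_spanning_tree T G}"
  proof (rule bij_betw_imageI)
    show "inj_on ?g (trees ?V ?E)" by (auto simp: inj_on_def)
    have "undirected_spanning_tree (?g T) G \<longleftrightarrow> T \<in> trees ?V ?E" for T
    proof (cases "T \<subseteq> ?E \<and> sym T")
      case True
      then have TV: "T \<subseteq> ?V \<times> ?V" using ED(2) by auto
      interpret T: pair_wf_digraph "?g T" by (rule pair_wf_digraphI[OF TV])
      interpret G: pair_wf_digraph G by unfold_locales (use ED(2) in auto)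
      have "pair_graph (?g T)"
      proof
        show "finite (pverts (?g T))" using ED(1) by simp
        show "finite (parcs (?g T))" using True ED(5) finite_subset by auto
        show "fst e \<noteq> snd e" if "e \<in> parcs (?g T)" for e using that True ED(4) by (cases e) (auto simp: irrefl_def)
        show "symmetric (with_proj (?g T))" using True by (simp add: symmetric_def)
      qed
      moreover have "spanning (with_proj (?g T)) (with_proj G)"
        using True T.wf_digraph G.wf_digraph
        by (auto simp: spanning_def subgraph_def)
      moreover have "Digraph_Component.connected (with_proj (?g T)) \<longleftrightarrow> ?V \<times> ?V \<subseteq> T\<^sup>*"
        using connected_symmetric_iff[of T ?V] TV ne True by blast
      moreover have "T \<in> trees ?V ?E \<longleftrightarrow> ?V \<times> ?V \<subseteq> T\<^sup>* \<and>
          \<not> (\<exists>x y. (x, y) \<in> T \<and> (x, y) \<in> (del_edge x y T)\<^sup>*)"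
        using True unfolding trees_def by blast
      ultimately show ?thesis
        using bridges[of T] True unfolding undirected_spanning_tree_def undirected_tree_def by blast
    next
      case False
      have "\<not> undirected_spanning_tree (?g T) G"
      proof
        assume u: "undirected_spanning_tree (?g T) G"
        then interpret T: pair_graph "?g T" by (simp add: undirected_spanning_tree_def undirected_tree_def)
        have "sym T" using T.pair_sym_arcs by (simp add: symmetric_def)
        moreover have "T \<subseteq> ?E" using u by (auto simp: undirected_spanning_tree_def spanning_def subgraph_def)
        ultimately show False using False by simp
      qed
      then show ?thesis using False by (auto simp: trees_def)
    qed
    moreover have "T = ?g (parcs T)" if "undirected_spanning_tree T G" for T
      using that by (cases T) (auto simp: undirected_spanning_tree_def spanning_def)
    ultimately show "?g ` trees ?V ?E = {T. undirected_spanning_tree T G}" by (auto simp: image_iff) metis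
  qed
  then show ?thesis by (simp add: num_spanning_trees_def tree_count_def bij_betw_same_card)
qed

text \<open>A minimal connected spanning subgraph is a tree.\<close>

lemma tree_count_pos:
  assumes E: "simple_edges V E" and conn: "V \<times> V \<subseteq> E\<^sup>*"
  shows "0 < tree_count V E"
proof -
  note ED = simple_edgesD[OF E]
  define C where "C = {T. T \<subseteq> E \<and> sym T \<and> V \<times> V \<subseteq> T\<^sup>*}"
  have "finite C" by (rule finite_subset[of _ "Pow E"]) (use ED(5) in \<open>auto simp: C_def\<close>)
  moreover have "E \<in> C" using conn ED(3) unfolding C_def by blast
  then have "C \<noteq> {}" by blast
  ultimately obtain T where "T \<in> C" and min: "\<And>S. S \<in> C \<Longrightarrow> S \<subseteq> T \<Longrightarrow> S = T"
    using finite_has_minimal[of C] by metis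
  then have T: "T \<subseteq> E" "sym T" "V \<times> V \<subseteq> T\<^sup>*" unfolding C_def by blast+
  have "(x, y) \<notin> (del_edge x y T)\<^sup>*" if xy: "(x, y) \<in> T" for x y
  proof
    let ?F = "del_edge x y T"
    assume c: "(x, y) \<in> ?F\<^sup>*"
    have s: "sym ?F" using T(2) by (rule sym_del_edge)
    have "T \<subseteq> ?F \<union> {(x, y), (y, x)}" by blast
    also have "\<dots> \<subseteq> ?F\<^sup>*" using c rtrancl_symD[OF s c] r_into_rtrancl[of _ ?F] by blast
    finally have "T\<^sup>* \<subseteq> ?F\<^sup>*" by (rule rtrancl_subset_rtrancl)
    then have "?F \<in> C" using T s unfolding C_def by blast
    then have "?F = T" by (rule min) blast
    then show False using xy by blast
  qed
  then have "T \<in> trees V E" using T unfolding trees_def by blast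
  moreover have "finite (trees V E)" using finite_trees[OF ED(5), of V "\<lambda>_. True"] by simp
  ultimately show ?thesis unfolding tree_count_def using card_gt_0_iff by blast
qed

section \<open>The bound for joins\<close>

lemma joined_graph_join:
  assumes "pair_graph A" "pair_graph B"
  shows "joined (Inl ` pverts A) (Inr ` pverts B) (parcs (graph_join A B))"
proof -
  interpret A: pair_graph A by fact
  interpret B: pair_graph B by fact
  have symA: "sym (parcs A)" and symB: "sym (parcs B)"
    using A.pair_sym_arcs B.pair_sym_arcs by (simp_all add: symmetric_def)
  have arcs: "(Inl p, Inl q) \<in> parcs (graph_join A B) \<longleftrightarrow> (p, q) \<in> parcs A"
    "(Inr r, Inr s) \<in> parcs (graph_join A B) \<longleftrightarrow> (r, s) \<in> parcs B"
    "(Inl p, Inr r) \<in> parcs (graph_join A B) \<longleftrightarrow> p \<in> pverts A \<and> r \<in> pverts B"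
    "(Inr r, Inl p) \<in> parcs (graph_join A B) \<longleftrightarrow> p \<in> pverts A \<and> r \<in> pverts B" for p q r s
    by (force simp: graph_join_def)+
  have "sym (parcs (graph_join A B))"
  proof (rule symI)
    fix s t assume "(s, t) \<in> parcs (graph_join A B)"
    then show "(t, s) \<in> parcs (graph_join A B)"
      using symD[OF symA] symD[OF symB] by (cases s; cases t) (simp_all add: arcs)
  qed
  moreover have "irrefl (parcs (graph_join A B))"
  proof (rule irreflI)
    fix s show "(s, s) \<notin> parcs (graph_join A B)"
      using A.pair_no_loops B.pair_no_loops by (cases s) (fastforce simp: arcs)+
  qed
  moreover have "parcs (graph_join A B) \<subseteq> (Inl ` pverts A \<union> Inr ` pverts B) \<times> (Inl ` pverts A \<union> Inr ` pverts B)"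
  proof (rule subrelI)
    fix s t assume "(s, t) \<in> parcs (graph_join A B)"
    then show "(s, t) \<in> (Inl ` pverts A \<union> Inr ` pverts B) \<times> (Inl ` pverts A \<union> Inr ` pverts B)"
      using A.wellformed' B.wellformed' by (cases s; cases t) (auto simp: arcs)
  qed
  moreover have "Inl ` pverts A \<times> Inr ` pverts B \<subseteq> parcs (graph_join A B)"
    by (auto simp: graph_join_def)
  ultimately show ?thesis
    using A.pair_finite_verts B.pair_finite_verts
    by (auto simp: joined_def simple_edges_def)
qed

lemma joined_connected:
  assumes J: "joined A B E" and "A \<noteq> {}" "B \<noteq> {}"
  shows "(A \<union> B) \<times> (A \<union> B) \<subseteq> E\<^sup>*"
proof -
  note JD = joinedD[OF J]
  obtain a b where ab: "a \<in> A" "b \<in> B" using assms by auto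
  have "(p, a) \<in> E\<^sup>* \<and> (a, p) \<in> E\<^sup>*" if "p \<in> A \<union> B" for p
  proof (cases "p \<in> A")
    case True
    then have "(p, b) \<in> E" "(b, a) \<in> E" "(a, b) \<in> E" "(b, p) \<in> E" using JD(4,5) ab by auto
    then show ?thesis by (meson r_into_rtrancl rtrancl_into_rtrancl)
  next
    case False
    then have "(p, a) \<in> E" "(a, p) \<in> E" using JD(4,5) ab that by auto
    then show ?thesis by auto
  qed
  then show ?thesis by (auto intro: rtrancl_trans)
qed

theorem theorem1p1:
  fixes A :: "'a pair_pre_digraph" and B :: "'b pair_pre_digraph" and a b :: nat
  assumes "pair_graph A" and "pair_graph B"
    and "a = card (pverts A)" and "b = card (pverts B)"
    and "3 \<le> a" and "a \<le> b"
  shows "Q_ratio (graph_join A B) \<ge>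
    D_const a * lambda_const a ^ (b - a) * (real a / real b) ^ (2 * a - 2)"
proof -
  let ?G = "graph_join A B" let ?A = "Inl ` pverts A" let ?B = "Inr ` pverts B"
  let ?E = "parcs ?G"
  let ?r = "D_const a * lambda_const a ^ (b - a) * (real a / real b) ^ (2 * a - 2)"
  have J: "joined ?A ?B ?E" by (rule joined_graph_join[OF assms(1,2)])
  note JD = joinedD[OF J]
  have V: "pverts ?G = ?A \<union> ?B" by (auto simp: graph_join_def)
  have cards: "card ?A = a" "card ?B = b" using assms(3,4) by (simp_all add: card_image)
  have ne: "?A \<noteq> {}" "?B \<noteq> {}" using cards assms(5,6) by (metis card.empty not_numeral_le_zero le_trans)+
  have "ratio_ge (?A \<union> ?B) ?E ?r"
    by (rule ratio_ge_grow[OF assms(5,6) ratio_ge_diagonal[OF assms(5) ratio_ge_33] J cards])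
  then have "?r * (real (tree_count (pverts ?G) ?E))\<^sup>2 \<le> real (acyclic_count ?E) * real (strong_count (pverts ?G) ?E)"
    by (simp add: ratio_ge_def V)
  also have "\<dots> \<le> real (num_acyclic ?G) * real (num_totally_cyclic ?G)"
    using acyclic_count_le_num_acyclic[of ?G] strong_count_le_num_totally_cyclic[of ?G] JD(7,10) V
    by (intro mult_mono) auto
  finally have main: "?r * (real (num_spanning_trees ?G))\<^sup>2 \<le> real (num_acyclic ?G) * real (num_totally_cyclic ?G)"
    using num_spanning_trees_eq_tree_count[of ?G] JD(6) V ne by simp
  have "0 < num_spanning_trees ?G"
    using num_spanning_trees_eq_tree_count[of ?G] tree_count_pos[OF JD(6) joined_connected[OF J ne]] JD(6) V ne by simp
  then show ?thesis using main by (simp add: Q_ratio_def pos_le_divide_eq)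
qed

end
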